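(* Assume Kleene's $\exists^{2}$ is available. Each of the following functionals computes (in the sense of Kleene's S1–S9, relative to $\exists^{2}$) a strong Cantor realiser: (1) the structure functional $\Omega$, which on input a finite set $X\subset\mathbb{R}$ outputs a finite sequence $\Omega(X)=(x_{0},\dots,x_{k})$ of reals that includes all elements of $X$; (2) the non-monotone induction functional; (3) a realiser for the Baire category theorem, i.e. a functional that on input a sequence $(O_{n})_{n\in\mathbb{N}}$ of dense open subsets of $[0,1]$ outputs a real $y\in\bigcap_{n\in\mathbb{N}}O_{n}$.
   Context: Computability is Kleene's higher-order computability given by his schemes S1–S9; "$\Phi$ computes $\Psi$ given $\exists^{2}$" means $\Psi$ is S1–S9-computable in $\Phi$ together with $\exists^{2}$. Kleene's $\exists^{2}$ is the functional $\varphi:\mathbb{N}^{\mathbb{N}}\to\{0,1\}$ with $\varphi(f)=0\iff(\exists n)(f(n)=0)$. Reals are represented by fast-converging Cauchy sequences of rationals; subsets of $\mathbb{R}$ (including open sets) are given by their characteristic functions $\mathbb{R}\to\{0,1\}$. A set $A\subset\mathbb{R}$ is weakly countable if there is a height $H:\mathbb{R}\to\mathbb{N}$ for $A$, i.e. for every $n\in\mathbb{N}$ the set $A_{n}=\{x\in A: H(x)<n\}$ is finite. A strong Cantor realiser is a (partial) functional that on input a set $A\subset[0,1]$ together with a height $H$ for $A$ (so both $A$ and $H$ are inputs) outputs some $y\in[0,1]\setminus A$. The non-monotone induction functional is the functional that, given an operator $\Gamma$ on subsets of $\mathbb{N}$ (i.e. $\Gamma:2^{\mathbb{N}}\to 2^{\mathbb{N}}$),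 outputs the fixed point of the transfinite iteration $X_{0}=\emptyset$, $X_{\alpha+1}=X_{\alpha}\cup\Gamma(X_{\alpha})$, $X_{\lambda}=\bigcup_{\alpha<\lambda}X_{\alpha}$ for limit $\lambda$ (the set at which the iteration stabilises). *)

theory Defs
  imports "HOL-Analysis.Analysis" "HOL-Library.Nat_Bijection" "HOL-Library.Countable"
begin

section \<open>Kleene's schemes S1--S9 for arguments of pure type at most 3\<close>

type_synonym tp1 = "nat \<Rightarrow> nat"
type_synonym tp2 = "tp1 \<Rightarrow> nat"

text \<open>Arguments of type 0, 1, 2 are total. Arguments of type 3 may be partial, as the functionals
  under study are (e.g. one defined on finite sets only).\<close>
type_synonym tp3 = "tp2 \<Rightarrow> nat option"

text \<open>Following Kleene, an argument list consists of one list per type (the relative order of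
  arguments of distinct types is immaterial), and the second component of every index records the
  number of arguments of each type.\<close>
definition sig :: "nat list \<Rightarrow> tp1 list \<Rightarrow> tp2 list \<Rightarrow> tp3 list \<Rightarrow> nat" where
  "sig ns fs Fs Ps = list_encode [length ns, length fs, length Fs, length Ps]"

text \<open>Scheme S6: move the entry at position \<open>k\<close> to the front.\<close>
definition to_front :: "nat \<Rightarrow> 'a list \<Rightarrow> 'a list" where
  "to_front k xs = xs ! k # take k xs @ drop (Suc k) xs"

text \<open>\<open>kleene e ns fs Fs Ps r\<close> means \<open>{e}(ns, fs, Fs, Ps) \<simeq> r\<close>. In S8 the inner computation has to
  terminate for all values of the bound variable, and the resulting total object has to
  belong to the domain of the functional it is fed to. The types up to 3 are closed
  under the schemes, since S8 introduces variables of type at most 1.\<close>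
inductive kleene ::
  "nat \<Rightarrow> nat list \<Rightarrow> tp1 list \<Rightarrow> tp2 list \<Rightarrow> tp3 list \<Rightarrow> nat \<Rightarrow> bool" where
  S1: "kleene (list_encode [1, sig (x # ns) fs Fs Ps]) (x # ns) fs Fs Ps (Suc x)"
| S2: "kleene (list_encode [2, sig ns fs Fs Ps, q]) ns fs Fs Ps q"
| S3: "kleene (list_encode [3, sig (x # ns) fs Fs Ps]) (x # ns) fs Fs Ps x"
| S4: "\<lbrakk>kleene h ns fs Fs Ps y; kleene g (y # ns) fs Fs Ps z\<rbrakk>
    \<Longrightarrow> kleene (list_encode [4, sig ns fs Fs Ps, g, h]) ns fs Fs Ps z"
| S5_0: "kleene g ns fs Fs Ps z
    \<Longrightarrow> kleene (list_encode [5, sig (0 # ns) fs Fs Ps, g, h]) (0 # ns) fs Fs Ps z"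
| S5_Suc: "\<lbrakk>kleene (list_encode [5, sig (x # ns) fs Fs Ps, g, h]) (x # ns) fs Fs Ps y;
      kleene h (x # y # ns) fs Fs Ps z\<rbrakk>
    \<Longrightarrow> kleene (list_encode [5, sig (Suc x # ns) fs Fs Ps, g, h]) (Suc x # ns) fs Fs Ps z"
| S6_0: "\<lbrakk>k < length ns; kleene g (to_front k ns) fs Fs Ps z\<rbrakk>
    \<Longrightarrow> kleene (list_encode [6, sig ns fs Fs Ps, 0, k, g]) ns fs Fs Ps z"
| S6_1: "\<lbrakk>k < length fs; kleene g ns (to_front k fs) Fs Ps z\<rbrakk>
    \<Longrightarrow> kleene (list_encode [6, sig ns fs Fs Ps, 1, k, g]) ns fs Fs Ps z"
| S6_2: "\<lbrakk>k < length Fs; kleene g ns fs (to_front k Fs) Ps z\<rbrakk>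
    \<Longrightarrow> kleene (list_encode [6, sig ns fs Fs Ps, 2, k, g]) ns fs Fs Ps z"
| S6_3: "\<lbrakk>k < length Ps; kleene g ns fs Fs (to_front k Ps) z\<rbrakk>
    \<Longrightarrow> kleene (list_encode [6, sig ns fs Fs Ps, 3, k, g]) ns fs Fs Ps z"
| S7: "kleene (list_encode [7, sig (x # ns) (f # fs) Fs Ps]) (x # ns) (f # fs) Fs Ps (f x)"
| S8_2: "(\<And>x. kleene h (x # ns) fs (F # Fs) Ps (\<phi> x))
    \<Longrightarrow> kleene (list_encode [8, sig ns fs (F # Fs) Ps, 2, h]) ns fs (F # Fs) Ps (F \<phi>)"
| S8_3: "\<lbrakk>\<And>f. kleene h ns (f # fs) Fs (P # Ps) (\<Phi> f); P \<Phi> = Some z\<rbrakk>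
    \<Longrightarrow> kleene (list_encode [8, sig ns fs Fs (P # Ps), 3, h]) ns fs Fs (P # Ps) z"
| S9: "kleene x ns fs Fs Ps z
    \<Longrightarrow> kleene (list_encode [9, sig (x # ns @ ns') (fs @ fs') (Fs @ Fs') (Ps @ Ps'), sig ns fs Fs Ps])
          (x # ns @ ns') (fs @ fs') (Fs @ Fs') (Ps @ Ps') z"

definition E2 :: tp2 where
  "E2 f = (if \<exists>n. f n = 0 then 0 else 1)"

text \<open>Functionals that map a type 2 object to an element of Baire space are taken in the curried
  form \<open>tp2 \<Rightarrow> nat \<Rightarrow> nat option\<close>. The corresponding functional of pure type 3 receives the pair
  \<open>(F, m)\<close> coded as the single type 2 object \<open>G\<close> with \<open>G(1, f 0, f 1, \<dots>) = F f\<close> and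
  \<open>G(0, 0, \<dots>) = m\<close>.\<close>
definition pure3 :: "(tp2 \<Rightarrow> nat \<Rightarrow> nat option) \<Rightarrow> tp3" where
  "pure3 \<Phi> G = \<Phi> (\<lambda>f. G (case_nat 1 f)) (G (\<lambda>_. 0))"

text \<open>\<open>\<Psi>\<close> (with two inputs of type 2 and one of type 0) is S1--S9 computable in \<open>\<Phi>\<close> and \<open>\<exists>\<^sup>2\<close>.\<close>
definition computes_given_E2 ::
  "(tp2 \<Rightarrow> nat \<Rightarrow> nat option) \<Rightarrow> (tp2 \<Rightarrow> tp2 \<Rightarrow> nat \<Rightarrow> nat option) \<Rightarrow> bool" where
  "computes_given_E2 \<Phi> \<Psi> \<longleftrightarrow>
    (\<exists>e. \<forall>F H m r. kleene e [m] [] [F, H, E2] [pure3 \<Phi>] r \<longleftrightarrow> \<Psi> F H m = Some r)"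

section \<open>Representations\<close>

definition rat_seq :: "tp1 \<Rightarrow> nat \<Rightarrow> real" where
  "rat_seq f n = of_rat (nat_to_rat_surj (f n))"

definition names_real :: "tp1 \<Rightarrow> real \<Rightarrow> bool" where
  "names_real f x \<longleftrightarrow>
    (\<forall>n i. \<bar>rat_seq f n - rat_seq f (n + i)\<bar> < (1 / 2) ^ n) \<and> rat_seq f \<longlonglongrightarrow> x"

text \<open>No condition is imposed on the values of \<open>F\<close> at sequences that are not names of reals.\<close>
definition names_fun :: "tp2 \<Rightarrow> (real \<Rightarrow> nat) \<Rightarrow> bool" where
  "names_fun F h \<longleftrightarrow> (\<forall>f x. names_real f x \<longrightarrow> F f = h x)"

definition names_set :: "tp2 \<Rightarrow> real set \<Rightarrow> bool" where
  "names_set F X \<longleftrightarrow> names_fun F (indicator X)"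

text \<open>A sequence of sets is given by a single type 2 object whose argument \<open>case_nat n f\<close> is the
  number \<open>n\<close> followed by the sequence \<open>f\<close>; likewise for operators on subsets of \<open>\<nat>\<close>, which
  are curried.\<close>
definition names_set_seq :: "tp2 \<Rightarrow> (nat \<Rightarrow> real set) \<Rightarrow> bool" where
  "names_set_seq G O' \<longleftrightarrow> (\<forall>n. names_set (\<lambda>f. G (case_nat n f)) (O' n))"

definition names_operator :: "tp2 \<Rightarrow> (nat set \<Rightarrow> nat set) \<Rightarrow> bool" where
  "names_operator G \<Gamma> \<longleftrightarrow> (\<forall>X n. G (case_nat n (indicator X)) = indicator (\<Gamma> X) n)"

text \<open>A finite sequence \<open>(x 0, \<dots>, x k)\<close> of reals, coded by \<open>k\<close> followed by the names of the \<open>x i\<close>.\<close>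
definition names_fin_seq :: "tp1 \<Rightarrow> nat \<Rightarrow> (nat \<Rightarrow> real) \<Rightarrow> bool" where
  "names_fin_seq g k x \<longleftrightarrow>
    g 0 = k \<and> (\<forall>i\<le>k. names_real (\<lambda>n. g (Suc (prod_encode (i, n)))) (x i))"

section \<open>Strong Cantor realisers\<close>

definition is_height :: "(real \<Rightarrow> nat) \<Rightarrow> real set \<Rightarrow> bool" where
  "is_height h A \<longleftrightarrow> (\<forall>n. finite {x \<in> A. h x < n})"

definition strong_cantor_realiser :: "(tp2 \<Rightarrow> tp2 \<Rightarrow> nat \<Rightarrow> nat option) \<Rightarrow> bool" where
  "strong_cantor_realiser \<Psi> \<longleftrightarrow>
    (\<forall>A h F H. A \<subseteq> {0..1} \<and> is_height h A \<and> names_set F A \<and> names_fun H h \<longrightarrow>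
      (\<exists>g y. (\<forall>m. \<Psi> F H m = Some (g m)) \<and> names_real g y \<and> y \<in> {0..1} - A))"

section \<open>The functionals\<close>

definition structure_functional :: "(tp2 \<Rightarrow> nat \<Rightarrow> nat option) \<Rightarrow> bool" where
  "structure_functional \<Omega> \<longleftrightarrow>
    (\<forall>X F. finite X \<and> names_set F X \<longrightarrow>
      (\<exists>g k x. (\<forall>m. \<Omega> F m = Some (g m)) \<and> names_fin_seq g k x \<and> X \<subseteq> x ` {..k}))"

definition baire_realiser :: "(tp2 \<Rightarrow> nat \<Rightarrow> nat option) \<Rightarrow> bool" where
  "baire_realiser B \<longleftrightarrow>
    (\<forall>O' G. (\<forall>n. openin (top_of_set {0..1}) (O' n) \<and> {0..1} \<subseteq> closure (O' n)) \<and>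
        names_set_seq G O' \<longrightarrow>
      (\<exists>g y. (\<forall>m. B G m = Some (g m)) \<and> names_real g y \<and> y \<in> (\<Inter>n. O' n)))"

definition is_succ :: "'w rel \<Rightarrow> 'w \<Rightarrow> 'w \<Rightarrow> bool" where
  "is_succ r a b \<longleftrightarrow> a \<in> Field r \<and> b \<in> Field r \<and> underS r b = under r a"

text \<open>The iteration \<open>X\<close> of \<open>\<Gamma>\<close> along the well-order \<open>r\<close>, whose elements play the role of the
  ordinals below the order type of \<open>r\<close>.\<close>
definition transfinite_iteration ::
  "(nat set \<Rightarrow> nat set) \<Rightarrow> 'w rel \<Rightarrow> ('w \<Rightarrow> nat set) \<Rightarrow> bool" where
  "transfinite_iteration \<Gamma> r X \<longleftrightarrow> Well_order r \<and>
    (\<forall>a \<in> Field r. underS r a = {} \<longrightarrow> X a = {}) \<and>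
    (\<forall>a b. is_succ r a b \<longrightarrow> X b = X a \<union> \<Gamma> (X a)) \<and>
    (\<forall>a \<in> Field r. underS r a \<noteq> {} \<and> (\<nexists>b. is_succ r b a) \<longrightarrow> X a = (\<Union>b \<in> underS r a. X b))"

text \<open>The iteration strictly increases until it stabilises; hence, by Cantor's theorem, it does
  so along any well-ordering of all of \<open>nat set set\<close>.\<close>
definition stabilises_at :: "(nat set \<Rightarrow> nat set) \<Rightarrow> nat set \<Rightarrow> bool" where
  "stabilises_at \<Gamma> Z \<longleftrightarrow>
    (\<exists>(r :: nat set set rel) X a. transfinite_iteration \<Gamma> r X \<and> a \<in> Field r \<and> X a = Z \<and> Z \<union> \<Gamma> Z = Z)"

definition nonmonotone_induction_functional :: "(tp2 \<Rightarrow> nat \<Rightarrow> nat option) \<Rightarrow> bool" where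
  "nonmonotone_induction_functional \<Phi> \<longleftrightarrow>
    (\<forall>\<Gamma> G Z. names_operator G \<Gamma> \<and> stabilises_at \<Gamma> Z \<longrightarrow> (\<forall>m. \<Phi> G m = Some (indicator Z m)))"

end

theory Submission
  imports Defs
begin

text \<open>All three functionals are used to escape the finite sets \<open>{x \<in> A. h x < n}\<close>, whose union is \<open>A\<close>.
  The complements of these sets are open and dense, so a realiser of the Baire category theorem
  applies directly. The structure functional lists them, hence lists \<open>A\<close>, and a diagonal
  construction with nested intervals avoids the list. For non-monotone induction, a set \<open>X\<close> of
  numbers codes countably many elements of the Cantor set, and one step adds the element obtained
  from \<open>X\<close> by diagonalisation, provided that it belongs to \<open>A\<close>. The step needs an unused code number
  which does not depend on choices: it is the height \<open>n\<close> of the new element together with the least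
  index not yet used for height \<open>n\<close>, and such an index exists because only finitely many elements of
  \<open>A\<close> have height \<open>n\<close>. Where the iteration stabilises, the diagonal element is outside \<open>A\<close>.
  \<open>\<exists>\<^sup>2\<close> decides all arithmetical predicates, and this suffices to carry out these steps by S1--S9.\<close>

section \<open>Determinism of the schemes\<close>

declare list_encode.simps [simp del]

lemma sig_eq_iff [simp]:
  "sig ns fs Fs Ps = sig ns' fs' Fs' Ps' \<longleftrightarrow>
    length ns = length ns' \<and> length fs = length fs' \<and> length Fs = length Fs' \<and> length Ps = length Ps'"
  by (simp add: sig_def list_encode_eq)

text \<open>Index and arguments fix the last scheme, so inverting the second derivation yields the
  same one; in the S8 cases the inner functions agree pointwise. In \<open>ex_realiser\<close> this
  turns the relation into a partial function.\<close>

lemma kleene_deterministic: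
  assumes "kleene e ns fs Fs Ps r" and "kleene e ns fs Fs Ps r'"
  shows "r = r'"
  using assms
proof (induction arbitrary: r' rule: kleene.induct)
  case (S4 h ns fs Fs Ps y g z)
  from S4.prems obtain y' where "kleene h ns fs Fs Ps y'" "kleene g (y' # ns) fs Fs Ps r'"
    by (cases rule: kleene.cases) (simp_all add: list_encode_eq)
  with S4.IH show ?case by blast
next
  case (S5_Suc x ns fs Fs Ps g h y z)
  from S5_Suc.prems obtain y' where
    "kleene (list_encode [5, sig (x # ns) fs Fs Ps, g, h]) (x # ns) fs Fs Ps y'"
    "kleene h (x # y' # ns) fs Fs Ps r'"
    by (cases rule: kleene.cases) (simp_all add: list_encode_eq)
  with S5_Suc.IH show ?case by blast
next
  case (S8_2 h ns fs F Fs Ps \<phi>)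
  from S8_2.prems obtain \<psi> where "\<And>x. kleene h (x # ns) fs (F # Fs) Ps (\<psi> x)" "r' = F \<psi>"
    by (cases rule: kleene.cases) (simp_all add: list_encode_eq, metis)
  moreover from this(1) have "\<phi> = \<psi>" by (intro ext S8_2.IH)
  ultimately show ?case by simp
next
  case (S8_3 h ns fs Fs P Ps \<Phi> z)
  from S8_3.prems obtain \<Psi> where "\<And>f. kleene h ns (f # fs) Fs (P # Ps) (\<Psi> f)" "P \<Psi> = Some r'"
    by (cases rule: kleene.cases) (simp_all add: list_encode_eq, metis)
  moreover from this(1) have "\<Phi> = \<Psi>" by (intro ext S8_3.IH)
  ultimately show ?case using S8_3.hyps by simp
next
  case (S9 x ns fs Fs Ps z ns' fs' Fs' Ps')
  from S9.prems have "kleene x ns fs Fs Ps r'"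
    by (cases rule: kleene.cases) (simp_all add: list_encode_eq)
  with S9.IH show ?case by blast
qed (erule kleene.cases; simp add: list_encode_eq)+

section \<open>Codes of rationals\<close>

text \<open>A zero denominator needs no exclusion: \<open>Fract\<close> and real division both
  return 0 there.\<close>

lemma nat_to_rat_surj_prod_encode:
  "(of_rat (nat_to_rat_surj (prod_encode (a, b))) :: real) = of_int (int_decode a) / of_int (int_decode b)"
  by (cases "int_decode b = 0") (simp_all add: nat_to_rat_surj_def of_rat_rat rat_number_collapse)

lemma int_decode_even: "int_decode (2 * u) = int u"
  by (simp add: int_decode_def sum_decode_def)

lemma int_decode_odd: "int_decode (Suc (2 * u)) = - int u - 1"
  by (simp add: int_decode_def sum_decode_def)

text \<open>\<open>int_decode\<close> reads parity as sign (even is nonnegative, odd is negative),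
  so these are the four sign patterns of numerator and denominator.\<close>

lemma parity_cases:
  obtains (ee) u v where "c = prod_encode (2 * u, 2 * v)"
  | (eo) u v where "c = prod_encode (2 * u, Suc (2 * v))"
  | (oe) u v where "c = prod_encode (Suc (2 * u), 2 * v)"
  | (oo) u v where "c = prod_encode (Suc (2 * u), Suc (2 * v))"
proof -
  obtain i j where "c = prod_encode (i, j)" by (metis prod_decode_inverse surj_pair)
  moreover have "(\<exists>u. n = 2 * u) \<or> (\<exists>u. n = Suc (2 * u))" for n :: nat by presburger
  ultimately show ?thesis using that by metis
qed

text \<open>Clearing denominators leaves a statement on natural numbers, which the rules for
  \<open>decidable\<close> can process. Opposite signs give a value of at most 0, hence no
  condition; \<open>v = 0\<close> reflects division by zero.\<close>

lemma rat_code_le_iff: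
  "of_rat (nat_to_rat_surj c) * real K \<le> real N \<longleftrightarrow>
    (\<exists>u v. c = prod_encode (2 * u, 2 * v) \<and> (v = 0 \<or> u * K \<le> N * v) \<or>
      c = prod_encode (2 * u, Suc (2 * v)) \<or> c = prod_encode (Suc (2 * u), 2 * v) \<or>
      c = prod_encode (Suc (2 * u), Suc (2 * v)) \<and> Suc u * K \<le> N * Suc v)" (is "?L \<longleftrightarrow> ?R")
proof (cases c rule: parity_cases)
  case (ee u v)
  have R: "?R \<longleftrightarrow> v = 0 \<or> u * K \<le> N * v"
    unfolding ee prod_encode_eq prod.inject by (auto; presburger)
  have "?L \<longleftrightarrow> real u / real v * real K \<le> real N"
    by (simp add: ee nat_to_rat_surj_prod_encode int_decode_even)
  also have "\<dots> \<longleftrightarrow> v = 0 \<or> real (u * K) \<le> real (N * v)"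
    by (cases "v = 0") (simp_all add: pos_divide_le_eq)
  finally show ?thesis using R by (simp only: of_nat_le_iff)
next
  case (eo u v)
  have "?R" using eo by blast
  moreover have "real u / (- real v - 1) * real K \<le> 0"
    by (intro mult_nonpos_nonneg divide_nonneg_nonpos) auto
  ultimately show ?thesis
    by (simp add: eo nat_to_rat_surj_prod_encode int_decode_even int_decode_odd)
next
  case (oe u v)
  have "?R" using oe by blast
  moreover have "(- real u - 1) / real v * real K \<le> 0"
    by (intro mult_nonpos_nonneg divide_nonpos_nonneg) auto
  ultimately show ?thesis
    by (simp add: oe nat_to_rat_surj_prod_encode int_decode_even int_decode_odd)
next
  case (oo u v)
  have R: "?R \<longleftrightarrow> Suc u * K \<le> N * Suc v"
    unfolding oo prod_encode_eq prod.inject by (auto; presburger)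
  have "?L \<longleftrightarrow> (- real u - 1) / (- real v - 1) * real K \<le> real N"
    by (simp add: oo nat_to_rat_surj_prod_encode int_decode_odd)
  also have "(- real u - 1) / (- real v - 1) = real (Suc u) / real (Suc v)"
  proof -
    have "- real u - 1 = - real (Suc u)" "- real v - 1 = - real (Suc v)" by simp_all
    then show ?thesis by (simp only: minus_divide_divide)
  qed
  also have "real (Suc u) / real (Suc v) * real K \<le> real N \<longleftrightarrow> real (Suc u * K) \<le> real (N * Suc v)"
    by (simp add: pos_divide_le_eq algebra_simps)
  finally show ?thesis using R by (simp only: of_nat_le_iff)
qed

text \<open>Here equal signs are the unconditional cases. Bounds of the form \<open>- real N\<close>
  are enough for the lower end of the unit interval.\<close>

lemma rat_code_ge_iff:
  "- real N \<le> of_rat (nat_to_rat_surj c) * real K \<longleftrightarrow>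
    (\<exists>u v. c = prod_encode (2 * u, 2 * v) \<or> c = prod_encode (Suc (2 * u), Suc (2 * v)) \<or>
      c = prod_encode (2 * u, Suc (2 * v)) \<and> u * K \<le> N * Suc v \<or>
      c = prod_encode (Suc (2 * u), 2 * v) \<and> (v = 0 \<or> Suc u * K \<le> N * v))" (is "?L \<longleftrightarrow> ?R")
proof (cases c rule: parity_cases)
  case (ee u v)
  then have "?R" by blast
  moreover have "0 \<le> real u / real v * real K" by simp
  then have "- real N \<le> real u / real v * real K" by linarith
  ultimately show ?thesis
    by (simp add: ee nat_to_rat_surj_prod_encode int_decode_even)
next
  case (oo u v)
  then have "?R" by blast
  moreover have "0 \<le> (- real u - 1) / (- real v - 1) * real K"
    by (intro mult_nonneg_nonneg divide_nonpos_nonpos) auto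
  then have "- real N \<le> (- real u - 1) / (- real v - 1) * real K" by linarith
  ultimately show ?thesis
    by (simp add: oo nat_to_rat_surj_prod_encode int_decode_odd)
next
  case (eo u v)
  have R: "?R \<longleftrightarrow> u * K \<le> N * Suc v"
    unfolding eo prod_encode_eq prod.inject by (auto; presburger)
  have "?L \<longleftrightarrow> - real N \<le> real u / (- real v - 1) * real K"
    by (simp add: eo nat_to_rat_surj_prod_encode int_decode_even int_decode_odd)
  also have "real u / (- real v - 1) = - (real u / real (Suc v))"
    using minus_divide_right[of "real u" "real v + 1"] by (simp add: algebra_simps)
  also have "- real N \<le> - (real u / real (Suc v)) * real K \<longleftrightarrow> real (u * K) \<le> real (N * Suc v)"
    by (simp add: pos_divide_le_eq algebra_simps)
  finally show ?thesis using R by (simp only: of_nat_le_iff)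
next
  case (oe u v)
  have R: "?R \<longleftrightarrow> v = 0 \<or> Suc u * K \<le> N * v"
    unfolding oe prod_encode_eq prod.inject by (auto; presburger)
  have "?L \<longleftrightarrow> - real N \<le> (- real u - 1) / real v * real K"
    by (simp add: oe nat_to_rat_surj_prod_encode int_decode_even int_decode_odd)
  also have "(- real u - 1) / real v = - (real (Suc u) / real v)"
    by (simp add: minus_divide_left)
  also have "- real N \<le> - (real (Suc u) / real v) * real K \<longleftrightarrow> v = 0 \<or> real (Suc u * K) \<le> real (N * v)"
    by (cases "v = 0") (simp_all add: pos_divide_le_eq algebra_simps)
  finally show ?thesis using R by (simp only: of_nat_le_iff)
qed

section \<open>Computability in a functional and \<open>\<exists>\<^sup>2\<close>\<close>

named_theorems computable_intros

locale kleene_env =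
  fixes \<Phi> :: "tp2 \<Rightarrow> nat \<Rightarrow> nat option" and V :: "tp2 \<Rightarrow> tp2 \<Rightarrow> bool"
begin

text \<open>The environment consists of the inputs \<open>F\<close> and \<open>H\<close>, assumed to satisfy \<open>V\<close>, and of \<open>a\<close> numbers and \<open>b\<close>
  functions, with bound variables at the heads of the two lists. Under \<open>V\<close> all calls of \<open>\<Phi>\<close> will
  be defined, so that only total terms have to be considered.\<close>
definition computable :: "nat \<Rightarrow> nat \<Rightarrow> (tp2 \<Rightarrow> tp2 \<Rightarrow> nat list \<Rightarrow> tp1 list \<Rightarrow> nat) \<Rightarrow> bool" where
  "computable a b t \<longleftrightarrow> (\<exists>e. \<forall>F H ns fs. V F H \<longrightarrow> length ns = a \<longrightarrow> length fs = b \<longrightarrow>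
      kleene e ns fs [F, H, E2] [pure3 \<Phi>] (t F H ns fs))"

abbreviation decidable :: "nat \<Rightarrow> nat \<Rightarrow> (tp2 \<Rightarrow> tp2 \<Rightarrow> nat list \<Rightarrow> tp1 list \<Rightarrow> bool) \<Rightarrow> bool" where
  "decidable a b Q \<equiv> computable a b (\<lambda>F H ns fs. of_bool (Q F H ns fs))"

lemma computableI:
  assumes "\<And>F H ns fs. V F H \<Longrightarrow> length ns = a \<Longrightarrow> length fs = b \<Longrightarrow>
    kleene e ns fs [F, H, E2] [pure3 \<Phi>] (t F H ns fs)"
  shows "computable a b t"
  using assms unfolding computable_def by blast

lemma computableE:
  assumes "computable a b t"
  obtains e where "\<And>F H ns fs. V F H \<Longrightarrow> length ns = a \<Longrightarrow> length fs = b \<Longrightarrow>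
    kleene e ns fs [F, H, E2] [pure3 \<Phi>] (t F H ns fs)"
  using assms unfolding computable_def by blast

lemma computable_cong:
  assumes "computable a b t"
    and "\<And>F H ns fs. V F H \<Longrightarrow> length ns = a \<Longrightarrow> length fs = b \<Longrightarrow> t F H ns fs = u F H ns fs"
  shows "computable a b u"
  using assms unfolding computable_def by metis

text \<open>Every index contains the signature; as this depends on lengths alone, one index can
  serve all environments of a given shape.\<close>

lemma sig_length:
  assumes "length ns = a" "length fs = b"
  shows "sig ns fs [F, H, G] [P'] = list_encode [a, b, 3, 1]"
  using assms by (simp add: sig_def eval_nat_numeral)

section \<open>Constants, variables, let-binding and change of variables\<close>

lemma computable_const [computable_intros]: "computable a b (\<lambda>F H ns fs. q)"
proof (rule computableI)
  fix F H and ns :: "nat list" and fs :: "tp1 list"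
  assume "length ns = a" "length fs = b"
  from kleene.S2[of ns fs "[F, H, E2]" "[pure3 \<Phi>]" q, unfolded sig_length[OF this]]
  show "kleene (list_encode [2, list_encode [a, b, 3, 1], q]) ns fs [F, H, E2] [pure3 \<Phi>] q" .
qed

lemma computable_nth:
  assumes "k < a"
  shows "computable a b (\<lambda>F H ns fs. ns ! k)"
proof (rule computableI)
  fix F H and ns :: "nat list" and fs :: "tp1 list"
  assume l: "length ns = a" "length fs = b"
  let ?ms = "take k ns @ drop (Suc k) ns"
  have l': "length (ns ! k # ?ms) = a" using l assms by auto
  have "kleene (list_encode [3, list_encode [a, b, 3, 1]]) (to_front k ns) fs [F, H, E2] [pure3 \<Phi>] (ns ! k)"
    using kleene.S3[of "ns ! k" ?ms fs "[F, H, E2]" "[pure3 \<Phi>]", unfolded sig_length[OF l' l(2)]]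
    by (simp add: to_front_def)
  from kleene.S6_0[OF assms[folded l(1)] this, unfolded sig_length[OF l]]
  show "kleene (list_encode [6, list_encode [a, b, 3, 1], 0, k, list_encode [3, list_encode [a, b, 3, 1]]])
      ns fs [F, H, E2] [pure3 \<Phi>] (ns ! k)" .
qed

text \<open>Scheme S4 acts as a let-binding.\<close>
lemma computable_let:
  assumes "computable (Suc a) b (\<lambda>F H ns fs. t F H (hd ns) (tl ns) fs)" and "computable a b u"
  shows "computable a b (\<lambda>F H ns fs. t F H (u F H ns fs) ns fs)"
proof -
  obtain g where g: "\<And>F H ns fs. V F H \<Longrightarrow> length ns = Suc a \<Longrightarrow> length fs = b \<Longrightarrow>
    kleene g ns fs [F, H, E2] [pure3 \<Phi>] (t F H (hd ns) (tl ns) fs)" using assms(1) computableE by blast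
  obtain h where h: "\<And>F H ns fs. V F H \<Longrightarrow> length ns = a \<Longrightarrow> length fs = b \<Longrightarrow>
    kleene h ns fs [F, H, E2] [pure3 \<Phi>] (u F H ns fs)" using assms(2) computableE by blast
  show ?thesis
  proof (rule computableI)
    fix F H and ns :: "nat list" and fs :: "tp1 list"
    assume v: "V F H" and l: "length ns = a" "length fs = b"
    have "kleene g (u F H ns fs # ns) fs [F, H, E2] [pure3 \<Phi>] (t F H (u F H ns fs) ns fs)"
      using g[OF v, of "u F H ns fs # ns"] l by simp
    from kleene.S4[OF h[OF v l] this, unfolded sig_length[OF l]]
    show "kleene (list_encode [4, list_encode [a, b, 3, 1], g, h]) ns fs [F, H, E2] [pure3 \<Phi>]
      (t F H (u F H ns fs) ns fs)" .
  qed
qed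

text \<open>Since S9 passes on a prefix of the arguments only, the selected ones are first copied to the front by S4.\<close>
lemma computable_reindex:
  assumes t: "computable (length \<sigma>) b t" and \<sigma>: "\<forall>k\<in>set \<sigma>. k < a"
  shows "computable a b (\<lambda>F H ns fs. t F H (map ((!) ns) \<sigma>) fs)"
proof -
  obtain e where e: "\<And>F H ns fs. V F H \<Longrightarrow> length ns = length \<sigma> \<Longrightarrow> length fs = b \<Longrightarrow>
    kleene e ns fs [F, H, E2] [pure3 \<Phi>] (t F H ns fs)" using t computableE by blast
  \<comment> \<open>\<open>\<tau>\<close> is the suffix of \<open>\<sigma>\<close> whose entries
    have already been copied; the induction is on the number of entries still missing.\<close>
  have "\<exists>e. \<forall>F H ns fs. V F H \<longrightarrow> length ns = a \<longrightarrow> length fs = b \<longrightarrow>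
      kleene e (map ((!) ns) \<tau> @ ns) fs [F, H, E2] [pure3 \<Phi>] (t F H (map ((!) ns) \<sigma>) fs)"
    if "\<exists>\<rho>. \<sigma> = \<rho> @ \<tau>" for \<tau>
    using that
  proof (induction "length \<sigma> - length \<tau>" arbitrary: \<tau>)
    case 0
    then have \<tau>: "\<tau> = \<sigma>" by auto
    \<comment> \<open>S9 takes the index to run from the head of the number list, so S4 puts the
      constant \<open>e\<close> there first.\<close>
    let ?s = "list_encode [length \<sigma> + a, b, 3, 1]"
    let ?c = "list_encode [2, ?s, e]"
    let ?d = "list_encode [9, list_encode [Suc (length \<sigma> + a), b, 3, 1], list_encode [length \<sigma>, b, 3, 1]]"
    have "kleene (list_encode [4, ?s, ?d, ?c]) (map ((!) ns) \<sigma> @ ns) fs [F, H, E2] [pure3 \<Phi>] (t F H (map ((!) ns) \<sigma>) fs)"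
      if v: "V F H" and l: "length ns = a" "length fs = b" for F H ns fs
    proof -
      let ?ms = "map ((!) ns) \<sigma>"
      have l': "length (?ms @ ns) = length \<sigma> + a" using l by simp
      have c: "kleene ?c (?ms @ ns) fs [F, H, E2] [pure3 \<Phi>] e"
        using kleene.S2[of "?ms @ ns" fs "[F, H, E2]" "[pure3 \<Phi>]" e, unfolded sig_length[OF l' l(2)]] .
      have "kleene e ?ms fs [F, H, E2] [pure3 \<Phi>] (t F H ?ms fs)" using e v l by simp
      from kleene.S9[OF this, of ns "[]" "[]" "[]"]
      have d: "kleene ?d (e # ?ms @ ns) fs [F, H, E2] [pure3 \<Phi>] (t F H ?ms fs)"
        using l by (simp add: sig_def numeral_3_eq_3)
      from kleene.S4[OF c d, unfolded sig_length[OF l' l(2)]] show ?thesis .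
    qed
    then show ?case unfolding \<tau> by blast
  next
    case (Suc n)
    then obtain \<rho> where \<rho>: "\<sigma> = \<rho> @ \<tau>" by blast
    with Suc.hyps(2) have "\<rho> \<noteq> []" by auto
    then obtain \<rho>' k where \<rho>': "\<rho> = \<rho>' @ [k]" by (metis rev_exhaust)
    have k: "k < a" using \<rho> \<rho>' \<sigma> by simp
    have "n = length \<sigma> - length (k # \<tau>)" using Suc.hyps(2) by simp
    from Suc.hyps(1)[OF this] \<rho> \<rho>' obtain e' where e': "\<And>F H ns fs. V F H \<Longrightarrow> length ns = a \<Longrightarrow> length fs = b \<Longrightarrow>
      kleene e' (ns ! k # map ((!) ns) \<tau> @ ns) fs [F, H, E2] [pure3 \<Phi>] (t F H (map ((!) ns) \<sigma>) fs)"
      by (metis (no_types) Cons_eq_appendI append_assoc append_Nil list.simps(9))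
    \<comment> \<open>The copies in front shift entry \<open>k\<close> of \<open>ns\<close> to
      position \<open>length \<tau> + k\<close>.\<close>
    have "length \<tau> + k < length \<tau> + a" using k by simp
    from computable_nth[OF this, of b] obtain h where h: "\<And>F H ns fs. V F H \<Longrightarrow> length ns = length \<tau> + a \<Longrightarrow>
      length fs = b \<Longrightarrow> kleene h ns fs [F, H, E2] [pure3 \<Phi>] (ns ! (length \<tau> + k))" using computableE by blast
    let ?s = "list_encode [length \<tau> + a, b, 3, 1]"
    have "kleene (list_encode [4, ?s, e', h]) (map ((!) ns) \<tau> @ ns) fs [F, H, E2] [pure3 \<Phi>] (t F H (map ((!) ns) \<sigma>) fs)"
      if v: "V F H" and l: "length ns = a" "length fs = b" for F H ns fs
    proof -
      let ?ms = "map ((!) ns) \<tau>"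
      have l': "length (?ms @ ns) = length \<tau> + a" using l by simp
      have "kleene h (?ms @ ns) fs [F, H, E2] [pure3 \<Phi>] (ns ! k)"
        using h[OF v l' l(2)] by (simp add: nth_append)
      from kleene.S4[OF this e'[OF v l], unfolded sig_length[OF l' l(2)]] show ?thesis .
    qed
    then show ?case by blast
  qed
  from this[of "[]"] show ?thesis unfolding computable_def by simp
qed

lemma map_nth_drop:
  assumes "length ns = k + a"
  shows "map ((!) ns) [k..<k + a] = drop k ns"
  using assms by (intro nth_equalityI) auto

text \<open>This carries a term under a further binder, as introduced by recursion and
  quantifiers.\<close>

lemma computable_weaken:
  assumes "computable a b t"
  shows "computable (Suc a) b (\<lambda>F H ns fs. t F H (tl ns) fs)"
proof -
  have "computable (Suc a) b (\<lambda>F H ns fs. t F H (map ((!) ns) [1..<1 + a]) fs)"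
    by (rule computable_reindex) (use assms in \<open>auto simp del: upt_Suc\<close>)
  then show ?thesis
    by (rule computable_cong) (simp only: map_nth_drop drop_Suc drop_0 One_nat_def plus_1_eq_Suc)
qed

text \<open>The new variable goes below the head: a case distinction sees only the predecessor,
  while the recursion behind it also binds the previous value.\<close>

lemma computable_weaken2:
  assumes "computable (Suc a) b (\<lambda>F H ns fs. t F H (hd ns) (tl ns) fs)"
  shows "computable (Suc (Suc a)) b (\<lambda>F H ns fs. t F H (hd ns) (tl (tl ns)) fs)"
proof -
  have "computable (Suc (Suc a)) b (\<lambda>F H ns fs.
      t F H (hd (map ((!) ns) (0 # [2..<2 + a]))) (tl (map ((!) ns) (0 # [2..<2 + a]))) fs)"
    by (rule computable_reindex) (use assms in \<open>auto simp del: upt_Suc\<close>)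
  then show ?thesis
  proof (rule computable_cong)
    fix F H and ns :: "nat list" and fs :: "tp1 list"
    assume "length ns = Suc (Suc a)"
    then obtain x y ms where "ns = x # y # ms" "length ms = a" by (metis length_Suc_conv)
    moreover from this have "map ((!) ns) [2..<2 + a] = drop 2 ns" by (intro map_nth_drop) simp
    ultimately show "t F H (hd (map ((!) ns) (0 # [2..<2 + a]))) (tl (map ((!) ns) (0 # [2..<2 + a]))) fs =
      t F H (hd ns) (tl (tl ns)) fs" by simp
  qed
qed

text \<open>Below nested binders variables appear as iterated tails; in this form the projections
  match the goals syntactically.\<close>

lemma computable_hd:
  assumes "k < a"
  shows "computable a b (\<lambda>F H ns fs. hd ((tl ^^ k) ns))"
proof -
  from computable_nth[OF assms] show ?thesis
  proof (rule computable_cong)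
    fix ns :: "nat list" assume "length ns = a"
    have "(tl ^^ k) ns = drop k ns" by (induction k) (simp_all add: drop_Suc tl_drop)
    with assms \<open>length ns = a\<close> show "ns ! k = hd ((tl ^^ k) ns)" by (simp add: hd_drop_conv_nth)
  qed
qed

lemmas computable_vars [computable_intros] =
  computable_hd[of 0, simplified]
  computable_hd[of "Suc 0", simplified]
  computable_hd[of "Suc (Suc 0)", simplified]
  computable_hd[of "Suc (Suc (Suc 0))", simplified]
  computable_hd[of "Suc (Suc (Suc (Suc 0)))", simplified]
  computable_hd[of "Suc (Suc (Suc (Suc (Suc 0))))", simplified]

section \<open>The schemes as closure rules for terms\<close>

lemma computable_Suc [computable_intros]:
  assumes "computable a b u"
  shows "computable a b (\<lambda>F H ns fs. Suc (u F H ns fs))"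
proof (rule computable_let[OF _ assms])
  show "computable (Suc a) b (\<lambda>F H ns fs. Suc (hd ns))"
  proof (rule computableI)
    fix F H and ns :: "nat list" and fs :: "tp1 list"
    assume l: "length ns = Suc a" "length fs = b"
    then obtain x ms where ns: "ns = x # ms" by (cases ns) auto
    from kleene.S1[of x ms fs "[F, H, E2]" "[pure3 \<Phi>]", folded ns, unfolded sig_length[OF l]]
    show "kleene (list_encode [1, list_encode [Suc a, b, 3, 1]]) ns fs [F, H, E2] [pure3 \<Phi>] (Suc (hd ns))"
      by (simp add: ns)
  qed
qed

lemma computable_hd_fs [computable_intros]:
  assumes "computable a b u" and "0 < b"
  shows "computable a b (\<lambda>F H ns fs. hd fs (u F H ns fs))"
proof (rule computable_let[OF _ assms(1)])
  show "computable (Suc a) b (\<lambda>F H ns fs. hd fs (hd ns))"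
  proof (rule computableI)
    fix F H and ns :: "nat list" and fs :: "tp1 list"
    assume l: "length ns = Suc a" "length fs = b"
    then obtain x ms f gs where ns: "ns = x # ms" "fs = f # gs"
      using assms(2) by (cases ns; cases fs) auto
    from kleene.S7[of x ms f gs "[F, H, E2]" "[pure3 \<Phi>]", folded ns, unfolded sig_length[OF l]]
    show "kleene (list_encode [7, list_encode [Suc a, b, 3, 1]]) ns fs [F, H, E2] [pure3 \<Phi>] (hd fs (hd ns))"
      by (simp add: ns)
  qed
qed

lemma computable_rec_nat [computable_intros]:
  assumes g: "computable a b g"
    and h: "computable (Suc (Suc a)) b (\<lambda>F H ns fs. h F H (hd ns) (hd (tl ns)) (tl (tl ns)) fs)"
    and u: "computable a b u"
  shows "computable a b (\<lambda>F H ns fs. rec_nat (g F H ns fs) (\<lambda>x y. h F H x y ns fs) (u F H ns fs))"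
proof (rule computable_let[OF _ u])
  obtain e where e: "\<And>F H ns fs. V F H \<Longrightarrow> length ns = a \<Longrightarrow> length fs = b \<Longrightarrow>
    kleene e ns fs [F, H, E2] [pure3 \<Phi>] (g F H ns fs)" using g computableE by blast
  obtain d where d: "\<And>F H ns fs. V F H \<Longrightarrow> length ns = Suc (Suc a) \<Longrightarrow> length fs = b \<Longrightarrow>
    kleene d ns fs [F, H, E2] [pure3 \<Phi>] (h F H (hd ns) (hd (tl ns)) (tl (tl ns)) fs)" using h computableE by blast
  show "computable (Suc a) b
    (\<lambda>F H ns fs. rec_nat (g F H (tl ns) fs) (\<lambda>x y. h F H x y (tl ns) fs) (hd ns))"
  proof (rule computableI)
    fix F H and ns :: "nat list" and fs :: "tp1 list"
    assume v: "V F H" and l: "length ns = Suc a" "length fs = b"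
    then obtain x ms where ns: "ns = x # ms" "length ms = a" by (cases ns) auto
    let ?i = "list_encode [5, list_encode [Suc a, b, 3, 1], e, d]"
    have "kleene ?i (x # ms) fs [F, H, E2] [pure3 \<Phi>] (rec_nat (g F H ms fs) (\<lambda>x y. h F H x y ms fs) x)"
    proof (induction x)
      case 0
      have l': "length (0 # ms) = Suc a" using ns by simp
      from kleene.S5_0[OF e[OF v ns(2) l(2)], unfolded sig_length[OF l' l(2)]] show ?case by simp
    next
      case (Suc x)
      let ?y = "rec_nat (g F H ms fs) (\<lambda>x y. h F H x y ms fs) x"
      have l': "length (x # ms) = Suc a" "length (Suc x # ms) = Suc a" using ns by simp_all
      have "kleene d (x # ?y # ms) fs [F, H, E2] [pure3 \<Phi>] (h F H x ?y ms fs)"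
        using d[OF v _ l(2), of "x # ?y # ms"] ns by simp
      from kleene.S5_Suc[OF _ this, unfolded sig_length[OF l'(1) l(2)] sig_length[OF l'(2) l(2)]] Suc
      show ?case by simp
    qed
    then show "kleene ?i ns fs [F, H, E2] [pure3 \<Phi>]
      (rec_nat (g F H (tl ns) fs) (\<lambda>x y. h F H x y (tl ns) fs) (hd ns))" by (simp add: ns)
  qed
qed

lemma computable_fun1 [computable_intros]:
  assumes "computable (Suc a) b (\<lambda>F H ns fs. \<phi> F H (hd ns) (tl ns) fs)"
  shows "computable a b (\<lambda>F H ns fs. F (\<lambda>x. \<phi> F H x ns fs))"
proof -
  obtain e where e: "\<And>F H ns fs. V F H \<Longrightarrow> length ns = Suc a \<Longrightarrow> length fs = b \<Longrightarrow>
    kleene e ns fs [F, H, E2] [pure3 \<Phi>] (\<phi> F H (hd ns) (tl ns) fs)" using assms computableE by blast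
  show ?thesis
  proof (rule computableI)
    fix F H and ns :: "nat list" and fs :: "tp1 list"
    assume v: "V F H" and l: "length ns = a" "length fs = b"
    have "kleene e (x # ns) fs [F, H, E2] [pure3 \<Phi>] (\<phi> F H x ns fs)" for x
      using e[OF v _ l(2), of "x # ns"] l by simp
    from kleene.S8_2[where \<phi> = "\<lambda>x. \<phi> F H x ns fs", OF this, unfolded sig_length[OF l]]
    show "kleene (list_encode [8, list_encode [a, b, 3, 1], 2, e]) ns fs [F, H, E2] [pure3 \<Phi>]
      (F (\<lambda>x. \<phi> F H x ns fs))" .
  qed
qed

text \<open>S8 applies only the first functional in the list, so S6 swaps \<open>H\<close> to the
  front; a second S6 inside the bound computation swaps back.\<close>

lemma computable_fun2 [computable_intros]:
  assumes "computable (Suc a) b (\<lambda>F H ns fs. \<phi> F H (hd ns) (tl ns) fs)"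
  shows "computable a b (\<lambda>F H ns fs. H (\<lambda>x. \<phi> F H x ns fs))"
proof -
  obtain e where e: "\<And>F H ns fs. V F H \<Longrightarrow> length ns = Suc a \<Longrightarrow> length fs = b \<Longrightarrow>
    kleene e ns fs [F, H, E2] [pure3 \<Phi>] (\<phi> F H (hd ns) (tl ns) fs)" using assms computableE by blast
  let ?s = "list_encode [a, b, 3, 1]" and ?s' = "list_encode [Suc a, b, 3, 1]"
  let ?i = "list_encode [6, ?s', 2, 1, e]"
  show ?thesis
  proof (rule computableI)
    fix F H and ns :: "nat list" and fs :: "tp1 list"
    assume v: "V F H" and l: "length ns = a" "length fs = b"
    have "kleene ?i (x # ns) fs [H, F, E2] [pure3 \<Phi>] (\<phi> F H x ns fs)" for x
    proof -
      have l': "length (x # ns) = Suc a" using l by simp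
      have "kleene e (x # ns) fs (to_front 1 [H, F, E2]) [pure3 \<Phi>] (\<phi> F H x ns fs)"
        using e[OF v l' l(2)] by (simp add: to_front_def)
      from kleene.S6_2[OF _ this, unfolded sig_length[OF l' l(2)]] show ?thesis by simp
    qed
    from kleene.S8_2[where \<phi> = "\<lambda>x. \<phi> F H x ns fs", OF this, unfolded sig_length[OF l]]
    have "kleene (list_encode [8, ?s, 2, ?i]) ns fs (to_front 1 [F, H, E2]) [pure3 \<Phi>]
      (H (\<lambda>x. \<phi> F H x ns fs))" by (simp add: to_front_def)
    from kleene.S6_2[OF _ this, unfolded sig_length[OF l]]
    show "kleene (list_encode [6, ?s, 2, 1, list_encode [8, ?s, 2, ?i]]) ns fs [F, H, E2] [pure3 \<Phi>]
      (H (\<lambda>x. \<phi> F H x ns fs))" by simp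
  qed
qed

text \<open>On three entries \<open>to_front 2\<close> is a rotation of order three: one use brings
  \<open>E2\<close> to the front, two more inside the bound computation restore the order.\<close>

lemma computable_E2:
  assumes "computable (Suc a) b (\<lambda>F H ns fs. \<phi> F H (hd ns) (tl ns) fs)"
  shows "computable a b (\<lambda>F H ns fs. E2 (\<lambda>x. \<phi> F H x ns fs))"
proof -
  obtain e where e: "\<And>F H ns fs. V F H \<Longrightarrow> length ns = Suc a \<Longrightarrow> length fs = b \<Longrightarrow>
    kleene e ns fs [F, H, E2] [pure3 \<Phi>] (\<phi> F H (hd ns) (tl ns) fs)" using assms computableE by blast
  let ?s = "list_encode [a, b, 3, 1]" and ?s' = "list_encode [Suc a, b, 3, 1]"
  let ?i = "list_encode [6, ?s', 2, 2, e]"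
  let ?j = "list_encode [6, ?s', 2, 2, ?i]"
  show ?thesis
  proof (rule computableI)
    fix F H and ns :: "nat list" and fs :: "tp1 list"
    assume v: "V F H" and l: "length ns = a" "length fs = b"
    have "kleene ?j (x # ns) fs [E2, F, H] [pure3 \<Phi>] (\<phi> F H x ns fs)" for x
    proof -
      have l': "length (x # ns) = Suc a" using l by simp
      have "kleene e (x # ns) fs (to_front 2 [H, E2, F]) [pure3 \<Phi>] (\<phi> F H x ns fs)"
        using e[OF v l' l(2)] by (simp add: to_front_def)
      from kleene.S6_2[OF _ this, unfolded sig_length[OF l' l(2)]]
      have "kleene ?i (x # ns) fs (to_front 2 [E2, F, H]) [pure3 \<Phi>] (\<phi> F H x ns fs)"
        by (simp add: to_front_def)
      from kleene.S6_2[OF _ this, unfolded sig_length[OF l' l(2)]] show ?thesis by simp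
    qed
    from kleene.S8_2[where \<phi> = "\<lambda>x. \<phi> F H x ns fs", OF this, unfolded sig_length[OF l]]
    have "kleene (list_encode [8, ?s, 2, ?j]) ns fs (to_front 2 [F, H, E2]) [pure3 \<Phi>]
      (E2 (\<lambda>x. \<phi> F H x ns fs))" by (simp add: to_front_def)
    from kleene.S6_2[OF _ this, unfolded sig_length[OF l]]
    show "kleene (list_encode [6, ?s, 2, 2, list_encode [8, ?s, 2, ?j]]) ns fs [F, H, E2] [pure3 \<Phi>]
      (E2 (\<lambda>x. \<phi> F H x ns fs))" by simp
  qed
qed

lemma computable_pure3:
  assumes "computable a (Suc b) (\<lambda>F H ns fs. \<phi> F H (hd fs) ns (tl fs))"
    and "\<And>F H ns fs. V F H \<Longrightarrow> pure3 \<Phi> (\<lambda>f. \<phi> F H f ns fs) = Some (t F H ns fs)"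
  shows "computable a b t"
proof -
  obtain e where e: "\<And>F H ns fs. V F H \<Longrightarrow> length ns = a \<Longrightarrow> length fs = Suc b \<Longrightarrow>
    kleene e ns fs [F, H, E2] [pure3 \<Phi>] (\<phi> F H (hd fs) ns (tl fs))" using assms(1) computableE by blast
  show ?thesis
  proof (rule computableI)
    fix F H and ns :: "nat list" and fs :: "tp1 list"
    assume v: "V F H" and l: "length ns = a" "length fs = b"
    have "kleene e ns (f # fs) [F, H, E2] [pure3 \<Phi>] (\<phi> F H f ns fs)" for f
      using e[OF v l(1), of "f # fs"] l by simp
    from kleene.S8_3[where \<Phi> = "\<lambda>f. \<phi> F H f ns fs", OF this assms(2)[OF v], unfolded sig_length[OF l]]
    show "kleene (list_encode [8, list_encode [a, b, 3, 1], 3, e]) ns fs [F, H, E2] [pure3 \<Phi>]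
      (t F H ns fs)" .
  qed
qed

section \<open>Case distinction, connectives and quantifiers\<close>

text \<open>Recursion on the truth value: 0 returns the base \<open>v\<close>, and the single step
  for 1 returns \<open>u\<close>.\<close>

lemma computable_if [computable_intros]:
  assumes "decidable a b Q" and u: "computable a b u" and v: "computable a b v"
  shows "computable a b (\<lambda>F H ns fs. if Q F H ns fs then u F H ns fs else v F H ns fs)"
  by (rule computable_cong[OF computable_rec_nat[OF v
        computable_weaken[OF computable_weaken[OF u]] assms(1)]]) simp

lemma computable_case_nat [computable_intros]:
  assumes "computable a b u"
    and v: "computable (Suc a) b (\<lambda>F H ns fs. v F H (hd ns) (tl ns) fs)" and "computable a b n"
  shows "computable a b (\<lambda>F H ns fs. case n F H ns fs of 0 \<Rightarrow> u F H ns fs | Suc k \<Rightarrow> v F H k ns fs)"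
proof -
  from v have "computable (Suc (Suc a)) b (\<lambda>F H ns fs. v F H (hd ns) (tl (tl ns)) fs)"
    by (rule computable_weaken2)
  from computable_rec_nat[OF assms(1) this assms(3)] show ?thesis
    by (rule computable_cong) (simp split: nat.split)
qed

lemma decidable_not [computable_intros]:
  assumes "decidable a b Q"
  shows "decidable a b (\<lambda>F H ns fs. \<not> Q F H ns fs)"
  by (rule computable_cong[OF computable_if[OF assms computable_const[where q = 0] computable_const[where q = 1]]]) simp

lemma decidable_conj [computable_intros]:
  assumes "decidable a b Q" "decidable a b R"
  shows "decidable a b (\<lambda>F H ns fs. Q F H ns fs \<and> R F H ns fs)"
  by (rule computable_cong[OF computable_if[OF assms computable_const[where q = 0]]]) simp

lemma decidable_disj [computable_intros]:
  assumes "decidable a b Q" "decidable a b R"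
  shows "decidable a b (\<lambda>F H ns fs. Q F H ns fs \<or> R F H ns fs)"
  by (rule computable_cong[OF computable_if[OF assms(1) computable_const[where q = 1] assms(2)]]) simp

lemma decidable_imp [computable_intros]:
  assumes "decidable a b Q" "decidable a b R"
  shows "decidable a b (\<lambda>F H ns fs. Q F H ns fs \<longrightarrow> R F H ns fs)"
  by (rule computable_cong[OF computable_if[OF assms computable_const[where q = 1]]]) simp

text \<open>The only place where \<open>E2\<close> is consulted. The truth value of
  \<open>\<not> Q\<close> vanishes exactly at the witnesses, so \<open>E2\<close> returns the truth
  value of there being none.\<close>

lemma decidable_ex [computable_intros]:
  assumes "decidable (Suc a) b (\<lambda>F H ns fs. Q F H (hd ns) (tl ns) fs)"
  shows "decidable a b (\<lambda>F H ns fs. \<exists>x. Q F H x ns fs)"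
proof -
  have "decidable a b (\<lambda>F H ns fs. \<forall>x. \<not> Q F H x ns fs)"
    by (rule computable_cong[OF computable_E2[where \<phi> = "\<lambda>F H x ns fs. of_bool (\<not> Q F H x ns fs)",
            OF decidable_not[OF assms]]]) (simp add: E2_def)
  from decidable_not[OF this] show ?thesis by simp
qed

lemma decidable_all [computable_intros]:
  assumes "decidable (Suc a) b (\<lambda>F H ns fs. Q F H (hd ns) (tl ns) fs)"
  shows "decidable a b (\<lambda>F H ns fs. \<forall>x. Q F H x ns fs)"
  using decidable_not[OF decidable_ex[OF decidable_not[OF assms]]] by simp

section \<open>Arithmetic and pairing\<close>

lemma computable_add [computable_intros]:
  assumes "computable a b u" "computable a b v"
  shows "computable a b (\<lambda>F H ns fs. u F H ns fs + v F H ns fs)"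
proof -
  have "n + k = rec_nat n (\<lambda>_. Suc) k" for n k :: nat by (induction k) simp_all
  then show ?thesis by (simp only:) (intro computable_intros assms; simp)
qed

lemma computable_mult [computable_intros]:
  assumes "computable a b u" "computable a b v"
  shows "computable a b (\<lambda>F H ns fs. u F H ns fs * v F H ns fs)"
proof -
  have "n * k = rec_nat 0 (\<lambda>_ y. y + n) k" for n k :: nat by (induction k) simp_all
  then show ?thesis by (simp only:) (intro computable_intros computable_weaken assms; simp)
qed

lemma computable_power [computable_intros]:
  assumes "computable a b u" "computable a b v"
  shows "computable a b (\<lambda>F H ns fs. u F H ns fs ^ v F H ns fs)"
proof -
  have "n ^ k = rec_nat 1 (\<lambda>_ y. n * y) k" for n k :: nat by (induction k) simp_all
  then show ?thesis by (simp only:) (intro computable_intros computable_weaken assms; simp)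
qed

lemma computable_diff [computable_intros]:
  assumes "computable a b u" "computable a b v"
  shows "computable a b (\<lambda>F H ns fs. u F H ns fs - v F H ns fs)"
proof -
  have "rec_nat 0 (\<lambda>x _. x) y = y - 1" for y :: nat by (cases y) simp_all
  then have "n - k = rec_nat n (\<lambda>_ y. rec_nat 0 (\<lambda>x _. x) y) k" for n k :: nat
    by (induction k) simp_all
  then show ?thesis by (simp only:) (intro computable_intros computable_weaken assms; simp)
qed

lemma decidable_le [computable_intros]:
  assumes "computable a b u" "computable a b v"
  shows "decidable a b (\<lambda>F H ns fs. u F H ns fs \<le> v F H ns fs)"
proof -
  have "of_bool (n \<le> k) = rec_nat (1 :: nat) (\<lambda>_ _. 0) (n - k)" for n k :: nat
    by (cases "n - k") auto
  then show ?thesis by (simp only:) (intro computable_intros assms; simp)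
qed

lemma decidable_less [computable_intros]:
  assumes "computable a b u" "computable a b v"
  shows "decidable a b (\<lambda>F H ns fs. u F H ns fs < v F H ns fs)"
  unfolding not_le[symmetric] by (intro computable_intros assms)

lemma decidable_eq [computable_intros]:
  assumes "computable a b u" "computable a b v"
  shows "decidable a b (\<lambda>F H ns fs. u F H ns fs = v F H ns fs)"
  unfolding order_eq_iff by (intro computable_intros assms)

lemma computable_prod_encode [computable_intros]:
  assumes "computable a b u" "computable a b v"
  shows "computable a b (\<lambda>F H ns fs. prod_encode (u F H ns fs, v F H ns fs))"
proof -
  have "triangle n = rec_nat 0 (\<lambda>x y. y + Suc x) n" for n by (induction n) simp_all
  then show ?thesis unfolding prod_encode_def prod.case
    by (simp only:) (intro computable_intros assms; simp)
qed

lemma computable_fst_prod_decode [computable_intros]: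
  assumes "computable a b u"
  shows "computable a b (\<lambda>F H ns fs. fst (prod_decode (u F H ns fs)))"
proof -
  \<comment> \<open>Search below \<open>n\<close> by recursion: exactly one \<open>x\<close> passes
    the test, and its value is kept once met.\<close>
  have *: "rec_nat 0 (\<lambda>x y. if \<exists>j. prod_encode (x, j) = k then x else y) n =
    (if fst (prod_decode k) < n then fst (prod_decode k) else 0)" for k n
  proof -
    have "(\<exists>j. prod_encode (x, j) = k) \<longleftrightarrow> x = fst (prod_decode k)" for x
      by (metis fst_conv prod.collapse prod_decode_inverse prod_encode_inverse)
    then show ?thesis by (induction n) auto
  qed
  \<comment> \<open>A component never exceeds its code, so a search below \<open>Suc k\<close> finds
    it.\<close>
  have "fst (prod_decode k) < Suc k" for k
    using le_prod_encode_1[of "fst (prod_decode k)" "snd (prod_decode k)"] by simp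
  with * have "fst (prod_decode k) = rec_nat 0 (\<lambda>x y. if \<exists>j. prod_encode (x, j) = k then x else y) (Suc k)" for k
    by presburger
  then show ?thesis by (simp only:) (intro computable_intros computable_weaken assms; simp)
qed

lemma computable_snd_prod_decode [computable_intros]:
  assumes "computable a b u"
  shows "computable a b (\<lambda>F H ns fs. snd (prod_decode (u F H ns fs)))"
proof -
  have *: "rec_nat 0 (\<lambda>x y. if \<exists>j. prod_encode (j, x) = k then x else y) n =
    (if snd (prod_decode k) < n then snd (prod_decode k) else 0)" for k n
  proof -
    have "(\<exists>j. prod_encode (j, x) = k) \<longleftrightarrow> x = snd (prod_decode k)" for x
      by (metis snd_conv prod.collapse prod_decode_inverse prod_encode_inverse)
    then show ?thesis by (induction n) auto
  qed
  have "snd (prod_decode k) < Suc k" for k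
    using le_prod_encode_2[of "snd (prod_decode k)" "fst (prod_decode k)"] by simp
  with * have "snd (prod_decode k) = rec_nat 0 (\<lambda>x y. if \<exists>j. prod_encode (j, x) = k then x else y) (Suc k)" for k
    by presburger
  then show ?thesis by (simp only:) (intro computable_intros computable_weaken assms; simp)
qed

section \<open>Calls of the functional and comparison of rationals\<close>

text \<open>The type 2 object given to \<open>pure3\<close> must carry both arguments: on sequences
  starting with 0 it returns the number, on the others it evaluates \<open>G\<close> at the tail.
  The number is let-bound first so that it is a variable inside S8.\<close>

lemma computable_call:
  assumes G: "computable a (Suc b) (\<lambda>F H ns fs. G F H (\<lambda>n. hd fs (Suc n)) ns (tl fs))"
    and m: "computable a b m"
    and t: "\<And>F H m ns fs. V F H \<Longrightarrow> \<Phi> (\<lambda>f. G F H f ns fs) m = Some (t F H m ns fs)"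
  shows "computable a b (\<lambda>F H ns fs. t F H (m F H ns fs) ns fs)"
proof (rule computable_let[OF _ m])
  show "computable (Suc a) b (\<lambda>F H ns fs. t F H (hd ns) (tl ns) fs)"
  proof (rule computable_pure3)
    show "computable (Suc a) (Suc b) (\<lambda>F H ns fs.
        case hd fs 0 of 0 \<Rightarrow> hd ns | Suc _ \<Rightarrow> G F H (\<lambda>n. hd fs (Suc n)) (tl ns) (tl fs))"
      by (rule computable_case_nat; (rule computable_weaken computable_weaken2)?;
          (intro computable_intros computable_weaken G; simp)?)
    show "pure3 \<Phi> (\<lambda>f. case f 0 of 0 \<Rightarrow> hd ns | Suc _ \<Rightarrow> G F H (\<lambda>n. f (Suc n)) (tl ns) fs) =
      Some (t F H (hd ns) (tl ns) fs)" if "V F H" for F H ns fs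
      using t[OF that] by (simp add: pure3_def)
  qed
qed

lemma decidable_rat_code_le [computable_intros]:
  assumes "computable a b c" "computable a b K" "computable a b N"
  shows "decidable a b (\<lambda>F H ns fs.
    of_rat (nat_to_rat_surj (c F H ns fs)) * real (K F H ns fs) \<le> real (N F H ns fs))"
  unfolding rat_code_le_iff by (intro computable_intros computable_weaken assms; simp)

lemma decidable_rat_code_ge [computable_intros]:
  assumes "computable a b c" "computable a b K" "computable a b N"
  shows "decidable a b (\<lambda>F H ns fs.
    - real (N F H ns fs) \<le> of_rat (nat_to_rat_surj (c F H ns fs)) * real (K F H ns fs))"
  unfolding rat_code_ge_iff by (intro computable_intros computable_weaken assms; simp)

end

section \<open>The Cantor set\<close>

text \<open>Base 4 numerals with digits 0 and 3 only: the gap between them makes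
  \<open>cantor_real\<close> injective and leaves room for decisions by approximation.\<close>

definition digits :: "nat set \<Rightarrow> nat \<Rightarrow> nat" where
  "digits D = rec_nat 0 (\<lambda>k N. 4 * N + 3 * of_bool (k \<in> D))"

text \<open>The sum of \<open>3 / 4 ^ Suc k\<close> over \<open>k \<in> D\<close>, with partial sums \<open>digits D m / 4 ^ m\<close>.\<close>
definition cantor_real :: "nat set \<Rightarrow> real" where
  "cantor_real D = (SUP m. real (digits D m) / 4 ^ m)"

text \<open>The factors 2 produce even codes, which \<open>int_decode\<close> reads as nonnegative
  integers.\<close>

definition cantor_name :: "nat set \<Rightarrow> tp1" where
  "cantor_name D m = prod_encode (2 * digits D m, 2 * 4 ^ m)"

lemma digits_0 [simp]: "digits D 0 = 0"
  and digits_Suc [simp]: "digits D (Suc m) = 4 * digits D m + 3 * of_bool (m \<in> D)"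
  by (simp_all add: digits_def)

lemma digits_lower: "digits D m * 4 ^ i \<le> digits D (m + i)"
  by (induction i) auto

text \<open>The next \<open>i\<close> digits add at most \<open>4 ^ i - 1\<close>, the numeral of
  \<open>i\<close> digits 3. The \<open>+ 1\<close> later gives the strict bound that names
  require.\<close>

lemma digits_upper: "digits D (m + i) + 1 \<le> (digits D m + 1) * 4 ^ i"
  by (induction i) auto

lemma digits_quotient_mono: "real (digits D m) / 4 ^ m \<le> real (digits D (m + i)) / 4 ^ (m + i)"
  using of_nat_mono[OF digits_lower[of D m i], where ?'a = real]
  by (simp add: field_simps power_add)

lemma digits_quotient_less: "real (digits D (m + i)) / 4 ^ (m + i) < (real (digits D m) + 1) / 4 ^ m"
proof -
  have "real (digits D (m + i)) < (real (digits D m) + 1) * 4 ^ i"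
    using of_nat_mono[OF digits_upper[of D m i], where ?'a = real] by (simp add: algebra_simps)
  then show ?thesis by (simp add: field_simps power_add)
qed

lemma digits_quotient_bound: "real (digits D n) / 4 ^ n \<le> (real (digits D m) + 1) / 4 ^ m"
proof -
  have "real (digits D n) / 4 ^ n \<le> real (digits D (m + n)) / 4 ^ (m + n)"
    using digits_quotient_mono[of D n m] by (simp add: add.commute)
  also have "\<dots> \<le> (real (digits D m) + 1) / 4 ^ m"
    using digits_quotient_less[of D m n] by simp
  finally show ?thesis .
qed

lemma bdd_above_digits: "bdd_above (range (\<lambda>m. real (digits D m) / 4 ^ m))"
  using digits_quotient_bound by (intro bdd_aboveI2)

lemma cantor_real_lower: "real (digits D m) / 4 ^ m \<le> cantor_real D"
  unfolding cantor_real_def by (rule cSUP_upper[OF UNIV_I bdd_above_digits])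

lemma cantor_real_upper: "cantor_real D \<le> (real (digits D m) + 1) / 4 ^ m"
  unfolding cantor_real_def by (rule cSUP_least) (simp_all add: digits_quotient_bound)

lemma cantor_real_in_unit: "cantor_real D \<in> {0..1}"
  using cantor_real_lower[of D 0] cantor_real_upper[of D 0] by simp

text \<open>Digit 3 selects the last quarter of the current interval;
  \<open>cantor_real_not_mem\<close> is the counterpart for digit 0 and the first quarter.\<close>

lemma cantor_real_mem:
  assumes "k \<in> D"
  shows "(4 * real (digits D k) + 3) / 4 ^ Suc k \<le> cantor_real D"
  using cantor_real_lower[of D "Suc k"] assms by (simp add: algebra_simps)

lemma cantor_real_not_mem:
  assumes "k \<notin> D"
  shows "cantor_real D \<le> (4 * real (digits D k) + 1) / 4 ^ Suc k"
  using cantor_real_upper[of D "Suc k"] assms by (simp add: algebra_simps)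

lemma digits_cong:
  assumes "\<And>i. i < k \<Longrightarrow> i \<in> D \<longleftrightarrow> i \<in> D'"
  shows "digits D k = digits D' k"
  using assms by (induction k) auto

lemma cantor_real_less:
  assumes "k \<in> D" "k \<notin> D'" "\<And>i. i < k \<Longrightarrow> i \<in> D \<longleftrightarrow> i \<in> D'"
  shows "cantor_real D' < cantor_real D"
proof -
  have "cantor_real D' \<le> (4 * real (digits D k) + 1) / 4 ^ Suc k"
    using cantor_real_not_mem[OF assms(2)] digits_cong[OF assms(3)] by simp
  also have "\<dots> < (4 * real (digits D k) + 3) / 4 ^ Suc k"
    by (intro divide_strict_right_mono) auto
  also have "\<dots> \<le> cantor_real D" by (rule cantor_real_mem[OF assms(1)])
  finally show ?thesis .
qed

lemma inj_cantor_real: "inj cantor_real"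
proof (rule injI, rule ccontr)
  fix D D' assume eq: "cantor_real D = cantor_real D'" and "D \<noteq> D'"
  then have "\<exists>k. k \<in> D \<longleftrightarrow> k \<notin> D'" by blast
  then obtain k where k: "k \<in> D \<longleftrightarrow> k \<notin> D'" and "\<And>i. i < k \<Longrightarrow> i \<in> D \<longleftrightarrow> i \<in> D'"
    using exists_least_iff[of "\<lambda>k. k \<in> D \<longleftrightarrow> k \<notin> D'"] by blast
  then show False using cantor_real_less[of k D D'] cantor_real_less[of k D' D] eq by fastforce
qed

lemma rat_seq_cantor_name: "rat_seq (cantor_name D) n = real (digits D n) / 4 ^ n"
  by (simp add: rat_seq_def cantor_name_def nat_to_rat_surj_prod_encode int_decode_even)

lemma names_real_cantor: "names_real (cantor_name D) (cantor_real D)"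
proof -
  have "\<bar>real (digits D n) / 4 ^ n - real (digits D (n + i)) / 4 ^ (n + i)\<bar> < (1 / 2) ^ n" for n i
  proof -
    have "\<bar>real (digits D n) / 4 ^ n - real (digits D (n + i)) / 4 ^ (n + i)\<bar> < 1 / 4 ^ n"
      using digits_quotient_mono[of D n i] digits_quotient_less[of D n i]
      by (simp add: add_divide_distrib)
    also have "\<dots> \<le> (1 / 2) ^ n"
      by (simp add: power_one_over[symmetric] power_mono)
    finally show ?thesis .
  qed
  moreover have "(\<lambda>n. real (digits D n) / 4 ^ n) \<longlonglongrightarrow> cantor_real D"
    unfolding cantor_real_def
  proof (rule LIMSEQ_incseq_SUP[OF bdd_above_digits])
    show "incseq (\<lambda>n. real (digits D n) / 4 ^ n)"
      using digits_quotient_mono[of D _ "Suc 0"] by (intro incseq_SucI) simp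
  qed
  ultimately show ?thesis unfolding names_real_def rat_seq_cantor_name by blast
qed

section \<open>Reading information off names of reals\<close>

lemma names_real_dist:
  assumes "names_real f x"
  shows "\<bar>rat_seq f n - x\<bar> \<le> (1 / 2) ^ n"
proof (rule tendsto_upperbound)
  have "(\<lambda>i. rat_seq f (i + n)) \<longlonglongrightarrow> x"
    using assms unfolding names_real_def by (intro LIMSEQ_ignore_initial_segment) blast
  then show "(\<lambda>i. \<bar>rat_seq f n - rat_seq f (i + n)\<bar>) \<longlonglongrightarrow> \<bar>rat_seq f n - x\<bar>"
    by (intro tendsto_intros)
  show "\<forall>\<^sub>F i in sequentially. \<bar>rat_seq f n - rat_seq f (i + n)\<bar> \<le> (1 / 2) ^ n"
    using assms unfolding names_real_def by (simp add: add.commute[of _ n] less_imp_le)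
qed simp

text \<open>Membership in the unit interval is a closed condition, so one universal quantifier over
  approximations with error \<open>1 / 2 ^ n\<close> captures it. Multiplying by
  \<open>2 ^ n\<close> gives the shape of the decidable comparisons.\<close>

definition unit_interval_test :: "tp1 \<Rightarrow> bool" where
  "unit_interval_test f \<longleftrightarrow> (\<forall>n. - real 1 \<le> of_rat (nat_to_rat_surj (f n)) * real (2 ^ n) \<and>
    of_rat (nat_to_rat_surj (f n)) * real (2 ^ n) \<le> real (2 ^ n + 1))"

lemma unit_interval_test:
  assumes "names_real f x"
  shows "unit_interval_test f \<longleftrightarrow> x \<in> {0..1}"
proof -
  have "unit_interval_test f \<longleftrightarrow> (\<forall>n. - ((1 / 2) ^ n) \<le> rat_seq f n \<and> rat_seq f n \<le> 1 + (1 / 2) ^ n)"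
    unfolding unit_interval_test_def rat_seq_def
    by (intro iff_allI) (simp add: field_simps)
  also have "\<dots> \<longleftrightarrow> x \<in> {0..1}"
  proof
    assume *: "\<forall>n. - ((1 / 2) ^ n) \<le> rat_seq f n \<and> rat_seq f n \<le> 1 + (1 / 2) ^ n"
    have l: "rat_seq f \<longlonglongrightarrow> x" using assms by (simp add: names_real_def)
    have z: "(\<lambda>n. (1 / 2) ^ n :: real) \<longlonglongrightarrow> 0" by (intro LIMSEQ_power_zero) simp
    have "- 0 \<le> x"
      using * by (intro tendsto_le[OF _ l tendsto_minus[OF z]]) auto
    moreover have "x \<le> 1 + 0"
      using * by (intro tendsto_le[OF _ tendsto_add[OF tendsto_const z] l]) auto
    ultimately show "x \<in> {0..1}" by simp
  next
    assume x: "x \<in> {0..1}"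
    show "\<forall>n. - ((1 / 2) ^ n) \<le> rat_seq f n \<and> rat_seq f n \<le> 1 + (1 / 2) ^ n"
    proof
      fix n
      show "- ((1 / 2) ^ n) \<le> rat_seq f n \<and> rat_seq f n \<le> 1 + (1 / 2) ^ n"
        using names_real_dist[OF assms, of n] x by (auto simp: abs_le_iff)
    qed
  qed
  finally show ?thesis .
qed

definition avoiding_digits :: "(nat \<Rightarrow> nat) \<Rightarrow> nat \<Rightarrow> nat" where
  "avoiding_digits q = rec_nat 0 (\<lambda>k N. 4 * N + 3 * of_bool
    (of_rat (nat_to_rat_surj (q k)) * real (4 ^ Suc k) \<le> real (4 * N + 2)))"

text \<open>At step \<open>k\<close> the current interval of length \<open>4 ^ - k\<close> shrinks to its first or last quarter; the
  approximation with error \<open>2 ^ - (2 * k + 3)\<close> tells which of them the \<open>k\<close>-th real avoids.\<close>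
lemma avoiding_digits:
  obtains D where "digits D = avoiding_digits q"
    and "\<And>k f x. names_real f x \<Longrightarrow> f (2 * k + 3) = q k \<Longrightarrow> cantor_real D \<noteq> x"
proof -
  let ?N = "avoiding_digits q"
  define D where "D = {k. of_rat (nat_to_rat_surj (q k)) * real (4 ^ Suc k) \<le> real (4 * ?N k + 2)}"
  have N: "digits D k = ?N k" for k
    by (induction k) (simp_all add: D_def avoiding_digits_def)
  moreover have "cantor_real D \<noteq> x" if x: "names_real f x" and q: "f (2 * k + 3) = q k" for k f x
  proof -
    let ?q = "rat_seq f (2 * k + 3)"
    have pos: "(0 :: real) < 4 ^ Suc k" by simp
    \<comment> \<open>The midpoint has distance \<open>1 / 4 ^ Suc k\<close> from both outer
      quarters; the error at index \<open>2 * k + 3\<close> is at most half of that.\<close>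
    have "(2 :: real) ^ (2 * k + 3) = 8 * 4 ^ k" by (simp add: power_add power_mult)
    then have "(1 / 2 :: real) ^ (2 * k + 3) < 1 / 4 ^ Suc k"
      by (simp add: power_one_over divide_strict_left_mono)
    with names_real_dist[OF x, of "2 * k + 3"] have d: "\<bar>?q - x\<bar> < 1 / 4 ^ Suc k" by linarith
    have k: "k \<in> D \<longleftrightarrow> ?q * 4 ^ Suc k \<le> 4 * real (digits D k) + 2"
    proof -
      have "k \<in> D \<longleftrightarrow> of_rat (nat_to_rat_surj (q k)) * real (4 ^ Suc k) \<le> real (4 * ?N k + 2)"
        by (simp only: D_def mem_Collect_eq)
      then show ?thesis by (simp add: N rat_seq_def q[symmetric] add.commute)
    qed
    show ?thesis
    proof (cases "k \<in> D")
      case True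
      with k have "?q \<le> (4 * real (digits D k) + 2) / 4 ^ Suc k" using pos by (simp add: pos_le_divide_eq)
      with d have "x < (4 * real (digits D k) + 2) / 4 ^ Suc k + 1 / 4 ^ Suc k" by linarith
      also have "\<dots> = (4 * real (digits D k) + 3) / 4 ^ Suc k" by (simp add: add_divide_distrib[symmetric])
      finally show ?thesis using cantor_real_mem[OF True] by linarith
    next
      case False
      with k have "(4 * real (digits D k) + 2) / 4 ^ Suc k < ?q" using pos by (simp add: pos_divide_less_eq)
      with d have "(4 * real (digits D k) + 2) / 4 ^ Suc k - 1 / 4 ^ Suc k < x" by linarith
      moreover have "(4 * real (digits D k) + 2) / 4 ^ Suc k - 1 / 4 ^ Suc k = (4 * real (digits D k) + 1) / 4 ^ Suc k"
        by (simp add: diff_divide_distrib[symmetric])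
      ultimately show ?thesis using cantor_real_not_mem[OF False] by linarith
    qed
  qed
  ultimately show ?thesis using that by blast
qed

section \<open>Non-monotone induction\<close>

text \<open>The single recursion \<open>X b = (\<Union>c \<in> underS r b. \<Gamma> (X c))\<close>
  satisfies the clauses for zero, successors and limits at once, and it traces each element of a
  stage back to the step that added it.\<close>

lemma exists_iteration:
  fixes \<Gamma> :: "nat set \<Rightarrow> nat set"
  obtains r :: "nat set set rel" and X a where "transfinite_iteration \<Gamma> r X" "a \<in> Field r"
    "X a \<union> \<Gamma> (X a) = X a" "\<And>b. X b = (\<Union>c \<in> underS r b. \<Gamma> (X c))" "Well_order r"
proof -
  obtain r :: "nat set set rel" where r: "Well_order r" and F: "Field r = UNIV"
    using well_ordering[where 'a = "nat set set"] by blast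
  have wo: "wo_rel r" by (simp add: wo_rel_def r)
  have wfr: "wf (r - Id)" by (rule wo_rel.WF[OF wo])
  define X where "X = wfrec (r - Id) (\<lambda>X b. \<Union>c \<in> underS r b. \<Gamma> (X c))"
  have X: "X b = (\<Union>c \<in> underS r b. \<Gamma> (X c))" for b
    unfolding X_def by (subst wfrec[OF wfr]) (auto simp: cut_def underS_def)
  have mono: "X c \<union> \<Gamma> (X c) \<subseteq> X b" if "c \<in> underS r b" for b c
  proof -
    have "underS r c \<subseteq> underS r b" using that underS_incr[OF wo_rel.TRANS[OF wo] wo_rel.ANTISYM[OF wo]] by (auto simp: underS_def)
    then show ?thesis using that by (subst (1 3) X) blast
  qed
  have tot: "c \<in> underS r b \<or> b \<in> underS r c" if "b \<noteq> c" for b c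
    using wo_rel.TOTAL[OF wo] F that unfolding total_on_def underS_def by blast
  have under: "under r b = insert b (underS r b)" for b
    using wo_rel.REFL[OF wo] F unfolding refl_on_def under_def underS_def by blast
  have it: "transfinite_iteration \<Gamma> r X"
    unfolding transfinite_iteration_def
  proof (intro conjI ballI allI impI)
    show "X b = {}" if "underS r b = {}" for b using that by (subst X) simp
    show "X c = X b \<union> \<Gamma> (X b)" if "is_succ r b c" for b c
      using that unfolding is_succ_def under by (subst (1 2) X) auto
    show "X b = (\<Union>c \<in> underS r b. X c)" if "underS r b \<noteq> {} \<and> (\<nexists>c. is_succ r c b)" for b
    proof
      show "(\<Union>c \<in> underS r b. X c) \<subseteq> X b" using mono by blast
      \<comment> \<open>Since \<open>b\<close> is not the successor of \<open>c\<close>, some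
        \<open>d\<close> lies strictly between them, and \<open>X d\<close> already contains
        \<open>\<Gamma> (X c)\<close>.\<close>
      have "\<Gamma> (X c) \<subseteq> (\<Union>c \<in> underS r b. X c)" if c: "c \<in> underS r b" for c
      proof -
        have "\<not> is_succ r c b" using \<open>underS r b \<noteq> {} \<and> _\<close> by blast
        moreover have "under r c \<subseteq> underS r b"
          using c underS_incr[OF wo_rel.TRANS[OF wo] wo_rel.ANTISYM[OF wo], of c b] unfolding under by (auto simp: underS_def)
        ultimately obtain d where d: "d \<in> underS r b" "d \<notin> under r c" unfolding is_succ_def F by blast
        then have "c \<in> underS r d" using tot[of c d] unfolding under by blast
        with mono d show ?thesis by blast
      qed
      then show "X b \<subseteq> (\<Union>c \<in> underS r b. X c)" by (subst X) blast
    qed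
  qed (rule r)
  have "\<exists>a. X a \<union> \<Gamma> (X a) = X a"
  proof (rule ccontr)
    assume "\<nexists>a. X a \<union> \<Gamma> (X a) = X a"
    \<comment> \<open>Without stabilisation \<open>X\<close> would inject \<open>nat set set\<close>
      into \<open>nat set\<close>, against Cantor's theorem.\<close>
    then have "X c \<noteq> X b" if "c \<in> underS r b" for b c using mono[OF that] by blast
    then have "inj X" using tot by (metis injI)
    then have "\<exists>g. surj (g :: nat set \<Rightarrow> nat set set)" using inj_imp_surj_inv by blast
    then show False using Cantors_theorem by (metis Pow_UNIV)
  qed
  with that it F X r show ?thesis by blast
qed

section \<open>The operator that adds a diagonal\<close>

text \<open>Digit \<open>k\<close> of the \<open>k\<close>-th coded element is flipped; it sits at
  \<open>Suc k\<close> because entry 0 of a column is the marker.\<close>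

definition diagonal :: "nat set \<Rightarrow> nat set" where
  "diagonal X = {k. prod_encode (k, Suc k) \<notin> X}"

definition unused :: "nat set \<Rightarrow> nat \<Rightarrow> nat \<Rightarrow> bool" where
  "unused X h j \<longleftrightarrow> prod_encode (prod_encode (h, j), 0) \<notin> X \<and>
    (\<forall>i<j. prod_encode (prod_encode (h, i), 0) \<in> X)"

definition column :: "nat \<Rightarrow> nat set \<Rightarrow> nat set" where
  "column k D = {n. n = prod_encode (k, 0) \<or> (\<exists>i. n = prod_encode (k, Suc i) \<and> i \<in> D)}"

text \<open>A set \<open>X\<close> codes countably many elements of the Cantor set, the \<open>k\<close>-th one having the digits
  \<open>{i. prod_encode (k, Suc i) \<in> X}\<close>; the pair \<open>(k, 0)\<close> marks \<open>k\<close> as used. The operator adds the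
  diagonal of \<open>X\<close> if it belongs to \<open>A\<close>.\<close>
definition add_diagonal :: "tp2 \<Rightarrow> tp2 \<Rightarrow> nat set \<Rightarrow> nat set" where
  "add_diagonal F H X = {n. F (cantor_name (diagonal X)) = 1 \<and>
    (\<exists>j. unused X (H (cantor_name (diagonal X))) j \<and>
      n \<in> column (prod_encode (H (cantor_name (diagonal X)), j)) (diagonal X))}"

lemma unused_unique: "unused X h i \<Longrightarrow> unused X h j \<Longrightarrow> i = j"
  unfolding unused_def by (meson linorder_neqE_nat)

lemma add_diagonal_cases:
  obtains "add_diagonal F H X = {}"
  | j where "F (cantor_name (diagonal X)) = 1" "unused X (H (cantor_name (diagonal X))) j"
    "add_diagonal F H X = column (prod_encode (H (cantor_name (diagonal X)), j)) (diagonal X)"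
proof (cases "F (cantor_name (diagonal X)) = 1 \<and> (\<exists>j. unused X (H (cantor_name (diagonal X))) j)")
  case True
  then obtain j where j: "F (cantor_name (diagonal X)) = 1" "unused X (H (cantor_name (diagonal X))) j" by blast
  then have "add_diagonal F H X = column (prod_encode (H (cantor_name (diagonal X)), j)) (diagonal X)"
    unfolding add_diagonal_def using unused_unique by blast
  with that j show ?thesis by blast
next
  case False
  then show ?thesis using that(1) unfolding add_diagonal_def by blast
qed

lemma mem_column_0: "prod_encode (k, 0) \<in> column k' D \<longleftrightarrow> k = k'"
  and mem_column_Suc: "prod_encode (k, Suc i) \<in> column k' D \<longleftrightarrow> k = k' \<and> i \<in> D"
  by (auto simp: column_def)

text \<open>If the diagonal of the stable set were in \<open>A\<close>, a free index at its height
  would let the operator add a new number. So it suffices that the earlier stages occupy only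
  finitely many indices at that height.\<close>

lemma diagonal_not_mem_of_stable:
  assumes h: "is_height h A" and F: "names_set F A" and H: "names_fun H h"
    and r: "Well_order r" and X: "\<And>b. X b = (\<Union>c \<in> underS r b. add_diagonal F H (X c))"
    and stable: "X a \<union> add_diagonal F H (X a) = X a"
  shows "cantor_real (diagonal (X a)) \<notin> A"
proof
  have wo: "wo_rel r" by (simp add: wo_rel_def r)
  define D where "D b = diagonal (X b)" for b
  have FA: "F (cantor_name E) = 1 \<longleftrightarrow> cantor_real E \<in> A" for E
  proof -
    have "F (cantor_name E) = indicator A (cantor_real E)"
      using F names_real_cantor unfolding names_set_def names_fun_def by blast
    then show ?thesis by (simp add: indicator_def)
  qed
  have Hh: "H (cantor_name E) = h (cantor_real E)" for E
    using H names_real_cantor unfolding names_fun_def by blast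
  \<comment> \<open>\<open>S\<close> will collect the stages that add something; such a stage
    \<open>b\<close> fills column \<open>k b\<close>, made of the height \<open>\<eta> b\<close> and
    the free index \<open>J b\<close>.\<close>
  define \<eta> where "\<eta> b = h (cantor_real (D b))" for b
  define J where "J b = (THE j. unused (X b) (\<eta> b) j)" for b
  define k where "k b = prod_encode (\<eta> b, J b)" for b
  define S where "S = {b. add_diagonal F H (X b) \<noteq> {}}"
  have S: "cantor_real (D b) \<in> A" "unused (X b) (\<eta> b) (J b)" "add_diagonal F H (X b) = column (k b) (D b)"
    if "b \<in> S" for b
  proof -
    obtain j where j: "F (cantor_name (D b)) = 1" "unused (X b) (\<eta> b) j"
      "add_diagonal F H (X b) = column (prod_encode (\<eta> b, j)) (D b)"
      using add_diagonal_cases[of F H "X b"] \<open>b \<in> S\<close> unfolding S_def D_def \<eta>_def Hh[symmetric] by blast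
    moreover have "J b = j" unfolding J_def using j(2) unused_unique by blast
    ultimately show "cantor_real (D b) \<in> A" "unused (X b) (\<eta> b) (J b)"
      "add_diagonal F H (X b) = column (k b) (D b)" by (simp_all add: FA[unfolded One_nat_def] k_def)
  qed
  have X': "X b = (\<Union>c \<in> underS r b \<inter> S. column (k c) (D c))" for b
    by (subst X) (use S(3) in \<open>auto simp: S_def\<close>)
  have used: "prod_encode (k b, 0) \<notin> X b" if "b \<in> S" for b
    using S(2)[OF that] by (simp add: unused_def k_def)
  have S_Field: "b \<in> Field r" if "b \<in> underS r c" for b c
    using that by (auto simp: underS_def Field_def)
  have tot: "c \<in> underS r b \<or> b \<in> underS r c" if "b \<noteq> c" "b \<in> Field r" "c \<in> Field r" for b c
    using wo_rel.TOTAL[OF wo] that unfolding total_on_def underS_def by blast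
  \<comment> \<open>The marker set at stage \<open>c\<close> lies in every later \<open>X b\<close>,
    while \<open>k b\<close> is chosen unmarked.\<close>
  have k_neq: "k c \<noteq> k b" if "c \<in> underS r b" "c \<in> S" "b \<in> S" for b c
    using used[OF that(3)] that unfolding X'[of b] by (fastforce simp: mem_column_0)
  then have k_inj: "b = c" if "k b = k c" "b \<in> S" "c \<in> S" "b \<in> Field r" "c \<in> Field r" for b c
    using that tot by metis
  have D_neq: "D c \<noteq> D b" if c: "c \<in> underS r b" "c \<in> S" for b c
  proof -
    \<comment> \<open>No other stage writes into column \<open>k c\<close>, so in \<open>X b\<close>
      it codes exactly \<open>D c\<close>, from which the diagonal differs at digit
      \<open>k c\<close>.\<close>
    have "prod_encode (k c, Suc (k c)) \<in> X b \<longleftrightarrow> k c \<in> D c"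
      unfolding X'[of b] using c k_inj S_Field by (auto simp: mem_column_Suc)
    then have "k c \<in> D b \<longleftrightarrow> k c \<notin> D c" by (simp add: D_def diagonal_def)
    then show ?thesis by blast
  qed
  assume A: "cantor_real (diagonal (X a)) \<in> A"
  \<comment> \<open>The earlier stages occupying indices at height \<open>\<eta> a\<close>. They add
    distinct elements of \<open>A\<close> of that height, so there are finitely many of
    them.\<close>
  let ?T = "{b \<in> underS r a \<inter> S. \<eta> b = \<eta> a}"
  have inj: "inj_on D (underS r a \<inter> S)"
    using D_neq tot S_Field by (intro inj_onI) (metis IntE)
  then have "inj_on (cantor_real \<circ> D) ?T"
    by (intro comp_inj_on inj_on_subset[OF inj] inj_on_subset[OF inj_cantor_real]) auto
  moreover have "(cantor_real \<circ> D) ` ?T \<subseteq> {x \<in> A. h x < Suc (\<eta> a)}"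
    using S(1) by (auto simp: \<eta>_def)
  moreover have "finite {x \<in> A. h x < Suc (\<eta> a)}" using h by (auto simp: is_height_def)
  ultimately have "finite ?T" by (meson finite_imageD finite_subset)
  then obtain j where "j \<notin> J ` ?T"
    using ex_new_if_finite[OF infinite_UNIV_nat finite_imageI] by blast
  then have "prod_encode (prod_encode (\<eta> a, j), 0) \<notin> X a"
    unfolding X'[of a] by (auto simp: mem_column_0 k_def)
  then obtain j where "prod_encode (prod_encode (\<eta> a, j), 0) \<notin> X a"
    "\<And>i. i < j \<Longrightarrow> prod_encode (prod_encode (\<eta> a, i), 0) \<in> X a"
    using exists_least_iff[of "\<lambda>j. prod_encode (prod_encode (\<eta> a, j), 0) \<notin> X a"] by blast
  then have j: "unused (X a) (\<eta> a) j" by (simp add: unused_def)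
  \<comment> \<open>The marker of the new column: stability puts it into \<open>X a\<close>, but
    \<open>j\<close> is free there.\<close>
  then have "prod_encode (prod_encode (\<eta> a, j), 0) \<in> add_diagonal F H (X a)"
    using A FA[of "diagonal (X a)"] by (auto simp: add_diagonal_def Hh \<eta>_def D_def mem_column_0)
  with stable j show False unfolding unused_def by blast
qed

section \<open>Strong Cantor realisers\<close>

definition cantor_input :: "tp2 \<Rightarrow> tp2 \<Rightarrow> real set \<Rightarrow> (real \<Rightarrow> nat) \<Rightarrow> bool" where
  "cantor_input F H A h \<longleftrightarrow> A \<subseteq> {0..1} \<and> is_height h A \<and> names_set F A \<and> names_fun H h"

lemma names_set_mem: "names_set F A \<Longrightarrow> names_real f x \<Longrightarrow> F f = 1 \<longleftrightarrow> x \<in> A"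
  by (simp add: names_set_def names_fun_def indicator_def)

text \<open>\<open>computes_given_E2\<close> constrains \<open>\<Psi>\<close> on all inputs,
  including those that name nothing. Hence \<open>\<Psi>\<close> is taken to be the partial function
  that the index \<open>e\<close> computes, which equals \<open>t\<close> on proper inputs.\<close>

lemma ex_realiser:
  fixes t :: "tp2 \<Rightarrow> tp2 \<Rightarrow> tp1"
  assumes "kleene_env.computable \<Phi> (\<lambda>F H. \<exists>A h. cantor_input F H A h) (Suc 0) 0 (\<lambda>F H ns fs. t F H (hd ns))"
    and t: "\<And>F H A h. cantor_input F H A h \<Longrightarrow> \<exists>y. names_real (t F H) y \<and> y \<in> {0..1} - A"
  shows "\<exists>\<Psi>. strong_cantor_realiser \<Psi> \<and> computes_given_E2 \<Phi> \<Psi>"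
proof -
  from assms(1) obtain e where e: "\<And>F H A h m. cantor_input F H A h \<Longrightarrow>
      kleene e [m] [] [F, H, E2] [pure3 \<Phi>] (t F H m)"
    unfolding kleene_env.computable_def by (metis length_Cons list.sel(1) list.size(3))
  define \<Psi> where "\<Psi> F H m = (if \<exists>r. kleene e [m] [] [F, H, E2] [pure3 \<Phi>] r
      then Some (THE r. kleene e [m] [] [F, H, E2] [pure3 \<Phi>] r) else None)" for F H m
  have \<Psi>: "\<Psi> F H m = Some r \<longleftrightarrow> kleene e [m] [] [F, H, E2] [pure3 \<Phi>] r" for F H m r
  proof
    assume r: "kleene e [m] [] [F, H, E2] [pure3 \<Phi>] r"
    then have "(THE r. kleene e [m] [] [F, H, E2] [pure3 \<Phi>] r) = r"
      by (rule the_equality) (rule kleene_deterministic[OF _ r])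
    with r show "\<Psi> F H m = Some r" unfolding \<Psi>_def by auto
  next
    assume "\<Psi> F H m = Some r"
    then obtain r' where r': "kleene e [m] [] [F, H, E2] [pure3 \<Phi>] r'"
      and r: "r = (THE r. kleene e [m] [] [F, H, E2] [pure3 \<Phi>] r)"
      unfolding \<Psi>_def by (auto split: if_splits)
    have "(THE r. kleene e [m] [] [F, H, E2] [pure3 \<Phi>] r) = r'"
      using r' by (rule the_equality) (rule kleene_deterministic[OF _ r'])
    with r r' show "kleene e [m] [] [F, H, E2] [pure3 \<Phi>] r" by simp
  qed
  have "strong_cantor_realiser \<Psi>"
    unfolding strong_cantor_realiser_def cantor_input_def[symmetric] \<Psi> using e t by blast
  moreover have "computes_given_E2 \<Phi> \<Psi>"
    unfolding computes_given_E2_def using \<Psi> by blast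
  ultimately show ?thesis by blast
qed

section \<open>The structure functional and nested intervals\<close>

lemma structure_functional_computes:
  assumes \<Omega>: "structure_functional \<Omega>"
  shows "\<exists>\<Psi>. strong_cantor_realiser \<Psi> \<and> computes_given_E2 \<Omega> \<Psi>"
proof -
  interpret kleene_env \<Omega> "\<lambda>F H. \<exists>A h. cantor_input F H A h" .
  define G :: "tp2 \<Rightarrow> tp2 \<Rightarrow> nat \<Rightarrow> tp2" where "G F H n f = of_bool (F f = 1 \<and> H f < n)" for F H n f
  \<comment> \<open>\<open>k\<close> codes a height bound and a position in the list for that bound;
    \<open>Suc\<close> skips the entry holding the length. Positions past the end give arbitrary
    rationals, which is harmless since only names have to be avoided.\<close>
  define q where "q F H k =
    the (\<Omega> (G F H (fst (prod_decode k))) (Suc (prod_encode (snd (prod_decode k), 2 * k + 3))))" for F H k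
  define t where "t F H m = prod_encode (2 * avoiding_digits (q F H) m, 2 * 4 ^ m)" for F H m
  have list: "\<exists>g k x. (\<forall>m. \<Omega> (G F H n) m = Some (g m)) \<and> names_fin_seq g k x \<and> {x \<in> A. h x < n} \<subseteq> x ` {..k}"
    if "cantor_input F H A h" for F H A h n
  proof -
    have "names_set (G F H n) {x \<in> A. h x < n}"
      using that unfolding cantor_input_def names_set_def names_fun_def by (auto simp: G_def indicator_def)
    moreover have "finite {x \<in> A. h x < n}" using that by (simp add: cantor_input_def is_height_def)
    ultimately show ?thesis using \<Omega> unfolding structure_functional_def by blast
  qed
  show ?thesis
  proof (rule ex_realiser)
    fix F H A h assume inp: "cantor_input F H A h"
    obtain D where D: "digits D = avoiding_digits (q F H)"
      "\<And>k f x. names_real f x \<Longrightarrow> f (2 * k + 3) = q F H k \<Longrightarrow> cantor_real D \<noteq> x"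
      using avoiding_digits by blast
    have "cantor_real D \<noteq> y" if y: "y \<in> A" for y
    proof -
      \<comment> \<open>The strict bound on the height admits \<open>y\<close> from this value
        on.\<close>
      let ?n = "Suc (h y)"
      obtain g k x where g: "\<forall>m. \<Omega> (G F H ?n) m = Some (g m)" "names_fin_seq g k x"
        "{x \<in> A. h x < ?n} \<subseteq> x ` {..k}" using list[OF inp] by blast
      then obtain i where i: "i \<le> k" "y = x i" using y by blast
      let ?k = "prod_encode (?n, i)"
      have "names_real (\<lambda>m. g (Suc (prod_encode (i, m)))) y" using g(2) i by (simp add: names_fin_seq_def)
      then show ?thesis by (rule D(2)[where k = ?k]) (simp add: q_def g(1))
    qed
    moreover have "t F H = cantor_name D" by (rule ext) (simp add: t_def cantor_name_def D(1))
    ultimately show "\<exists>y. names_real (t F H) y \<and> y \<in> {0..1} - A"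
      using names_real_cantor cantor_real_in_unit by fastforce
  next
    have q: "computable a b (\<lambda>F H ns fs. q F H (k F H ns fs))" if "computable a b k" for a b k
    proof (rule computable_let[OF _ that])
      have "computable (Suc a) b (\<lambda>F H ns fs. the (\<Omega> (G F H (fst (prod_decode (hd ns))))
          (Suc (prod_encode (snd (prod_decode (hd ns)), 2 * hd ns + 3)))))"
      proof (rule computable_call[where G = "\<lambda>F H f ns fs. G F H (fst (prod_decode (hd ns))) f"
            and t = "\<lambda>F H m ns fs. the (\<Omega> (G F H (fst (prod_decode (hd ns)))) m)"])
        show "computable (Suc a) (Suc b) (\<lambda>F H ns fs. G F H (fst (prod_decode (hd ns))) (\<lambda>n. hd fs (Suc n)))"
          unfolding G_def by (intro computable_intros; simp)
        show "computable (Suc a) b (\<lambda>F H ns fs. Suc (prod_encode (snd (prod_decode (hd ns)), 2 * hd ns + 3)))"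
          by (intro computable_intros; simp)
        show "\<Omega> (G F H (fst (prod_decode (hd ns)))) m = Some (the (\<Omega> (G F H (fst (prod_decode (hd ns)))) m))"
          if "\<exists>A h. cantor_input F H A h" for F H m and ns :: "nat list"
        proof -
          from that obtain A h where "cantor_input F H A h" by blast
          from list[OF this] obtain g where "\<forall>m. \<Omega> (G F H (fst (prod_decode (hd ns)))) m = Some (g m)" by blast
          then show ?thesis by simp
        qed
      qed
      then show "computable (Suc a) b (\<lambda>F H ns fs. q F H (hd ns))" by (simp add: q_def)
    qed
    show "computable (Suc 0) 0 (\<lambda>F H ns fs. t F H (hd ns))"
      unfolding t_def avoiding_digits_def by (intro computable_intros q; simp)
  qed
qed

section \<open>The Baire category theorem and complements of finite sets\<close>

lemma baire_realiser_computes: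
  assumes B: "baire_realiser B"
  shows "\<exists>\<Psi>. strong_cantor_realiser \<Psi> \<and> computes_given_E2 B \<Psi>"
proof -
  interpret kleene_env B "\<lambda>F H. \<exists>A h. cantor_input F H A h" .
  \<comment> \<open>\<open>f 0\<close> is the index of the open set and the tail names a point. The
    test keeps the sets within the unit interval.\<close>
  define G :: "tp2 \<Rightarrow> tp2 \<Rightarrow> tp2" where "G F H f = of_bool (unit_interval_test (\<lambda>n. f (Suc n)) \<and>
    \<not> (F (\<lambda>n. f (Suc n)) = 1 \<and> H (\<lambda>n. f (Suc n)) < f 0))" for F H f
  define t where "t F H m = the (B (G F H) m)" for F H m
  have main: "\<exists>g y. (\<forall>m. B (G F H) m = Some (g m)) \<and> names_real g y \<and> y \<in> {0..1} - A"
    if inp: "cantor_input F H A h" for F H A h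
  proof -
    define O' where "O' n = {0..1} - {x \<in> A. h x < n}" for n
    have fin: "finite {x \<in> A. h x < n}" for n using inp by (simp add: cantor_input_def is_height_def)
    have "openin (top_of_set {0..1}) (O' n)" for n
      unfolding O'_def using finite_imp_closed[OF fin]
      by (metis Diff_eq openin_open_Int open_Compl)
    moreover have "{0..1} \<subseteq> closure (O' n)" for n
    proof
      fix x :: real assume "x \<in> {0..1}"
      \<comment> \<open>Density: the interval has no isolated points, and removing finitely many
        points preserves limit points.\<close>
      then have "x islimpt {0..1}"
        by (intro connected_imp_perfect) (auto simp: atLeastAtMost_singleton_iff)
      moreover have "{0..1} = {x \<in> A. h x < n} \<union> O' n"
        using inp by (auto simp: O'_def cantor_input_def)
      ultimately show "x \<in> closure (O' n)"
        using islimpt_Un_finite[OF fin] by (metis UnCI closure_def mem_Collect_eq)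
    qed
    moreover have "names_set_seq (G F H) O'"
      unfolding names_set_seq_def names_set_def names_fun_def
    proof (intro allI impI)
      fix n f x assume f: "names_real f x"
      have "G F H (case_nat n f) = of_bool (unit_interval_test f \<and> \<not> (F f = 1 \<and> H f < n))"
        by (simp add: G_def)
      moreover have "F f = 1 \<longleftrightarrow> x \<in> A" "H f = h x"
        using inp f names_set_mem unfolding cantor_input_def names_fun_def by blast+
      ultimately show "G F H (case_nat n f) = indicator (O' n) x"
        unfolding unit_interval_test[OF f] by (simp add: O'_def indicator_def)
    qed
    ultimately have "\<exists>g y. (\<forall>m. B (G F H) m = Some (g m)) \<and> names_real g y \<and> y \<in> (\<Inter>n. O' n)"
      using B[unfolded baire_realiser_def, rule_format, of O' "G F H"] by blast
    then obtain g y where "\<forall>m. B (G F H) m = Some (g m)" "names_real g y" "y \<in> (\<Inter>n. O' n)" by blast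
    \<comment> \<open>If \<open>y\<close> were in \<open>A\<close>, it would have been removed from
      this set.\<close>
    moreover from this(3) have "y \<in> O' (Suc (h y))" by blast
    ultimately show ?thesis unfolding O'_def by auto
  qed
  show ?thesis
  proof (rule ex_realiser)
    fix F H A h assume "cantor_input F H A h"
    from main[OF this] obtain g y where "\<forall>m. B (G F H) m = Some (g m)" "names_real g y" "y \<in> {0..1} - A" by blast
    moreover from this(1) have "t F H = g" by (simp add: t_def fun_eq_iff)
    ultimately show "\<exists>y. names_real (t F H) y \<and> y \<in> {0..1} - A" by blast
  next
    show "computable (Suc 0) 0 (\<lambda>F H ns fs. t F H (hd ns))"
      unfolding t_def
    proof (rule computable_call[where G = "\<lambda>F H f ns fs. G F H f" and t = "\<lambda>F H m ns fs. the (B (G F H) m)"])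
      show "computable (Suc 0) (Suc 0) (\<lambda>F H ns fs. G F H (\<lambda>n. hd fs (Suc n)))"
        unfolding G_def unit_interval_test_def by (intro computable_intros; simp)
      show "computable (Suc 0) 0 (\<lambda>F H ns fs. hd ns)" by (intro computable_intros) simp
      show "B (G F H) m = Some (the (B (G F H) m))" if "\<exists>A h. cantor_input F H A h" for F H m
        using that main by fastforce
    qed
  qed
qed

section \<open>Non-monotone induction and the stable diagonal\<close>

lemma nonmonotone_induction_functional_computes:
  assumes \<Phi>: "nonmonotone_induction_functional \<Phi>"
  shows "\<exists>\<Psi>. strong_cantor_realiser \<Psi> \<and> computes_given_E2 \<Phi> \<Psi>"
proof -
  interpret kleene_env \<Phi> "\<lambda>F H. \<exists>A h. cantor_input F H A h" .
  \<comment> \<open>\<open>f\<close> is the number asked about followed by a characteristic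
    function; values other than 1 are read as non-membership.\<close>
  define G :: "tp2 \<Rightarrow> tp2 \<Rightarrow> tp2" where "G F H f = of_bool (f 0 \<in> add_diagonal F H {n. f (Suc n) = 1})" for F H f
  define t where "t F H = cantor_name (diagonal {n. the (\<Phi> (G F H) n) = 1})" for F H
  have main: "\<exists>Z. (\<forall>m. \<Phi> (G F H) m = Some (indicator Z m)) \<and> cantor_real (diagonal Z) \<notin> A"
    if inp: "cantor_input F H A h" for F H A h
  proof -
    obtain r :: "nat set set rel" and X a where r: "transfinite_iteration (add_diagonal F H) r X" "a \<in> Field r"
      "X a \<union> add_diagonal F H (X a) = X a" "\<And>b. X b = (\<Union>c \<in> underS r b. add_diagonal F H (X c))" "Well_order r"
      using exists_iteration by blast
    have "names_operator (G F H) (add_diagonal F H)"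
      by (simp add: names_operator_def G_def indicator_def)
    moreover have "stabilises_at (add_diagonal F H) (X a)"
      unfolding stabilises_at_def using r(1-3) by blast
    ultimately have "\<forall>m. \<Phi> (G F H) m = Some (indicator (X a) m)"
      using \<Phi> unfolding nonmonotone_induction_functional_def by blast
    moreover have "cantor_real (diagonal (X a)) \<notin> A"
      by (rule diagonal_not_mem_of_stable[OF _ _ _ r(5,4,3)]) (use inp in \<open>auto simp: cantor_input_def\<close>)
    ultimately show ?thesis by blast
  qed
  show ?thesis
  proof (rule ex_realiser)
    fix F H A h assume "cantor_input F H A h"
    from main[OF this] obtain Z where Z: "\<forall>m. \<Phi> (G F H) m = Some (indicator Z m)"
      "cantor_real (diagonal Z) \<notin> A" by blast
    have "t F H = cantor_name (diagonal Z)" by (simp add: t_def Z(1) indicator_def)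
    with Z(2) show "\<exists>y. names_real (t F H) y \<and> y \<in> {0..1} - A"
      using names_real_cantor[of "diagonal Z"] cantor_real_in_unit[of "diagonal Z"] by auto
  next
    \<comment> \<open>Each digit of the output asks about membership in the fixed point inside a
      recursion, so the call must be available at any computable argument and under any
      binders.\<close>
    have call: "computable a b (\<lambda>F H ns fs. the (\<Phi> (G F H) (m F H ns fs)))" if m: "computable a b m" for a b m
    proof (rule computable_call[where G = "\<lambda>F H f ns fs. G F H f" and t = "\<lambda>F H m ns fs. the (\<Phi> (G F H) m)", OF _ m])
      show "computable a (Suc b) (\<lambda>F H ns fs. G F H (\<lambda>n. hd fs (Suc n)))"
        unfolding G_def add_diagonal_def unused_def column_def diagonal_def cantor_name_def digits_def mem_Collect_eq
        by (intro computable_intros; simp)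
      show "\<Phi> (G F H) m = Some (the (\<Phi> (G F H) m))" if "\<exists>A h. cantor_input F H A h" for F H m
        using that main by fastforce
    qed
    show "computable (Suc 0) 0 (\<lambda>F H ns fs. t F H (hd ns))"
      unfolding t_def diagonal_def cantor_name_def digits_def mem_Collect_eq
      by (intro computable_intros call; simp)
  qed
qed

theorem theorem2p3:
  shows "(\<forall>\<Omega>. structure_functional \<Omega> \<longrightarrow>
            (\<exists>\<Psi>. strong_cantor_realiser \<Psi> \<and> computes_given_E2 \<Omega> \<Psi>)) \<and>
         (\<forall>\<Phi>. nonmonotone_induction_functional \<Phi> \<longrightarrow>
            (\<exists>\<Psi>. strong_cantor_realiser \<Psi> \<and> computes_given_E2 \<Phi> \<Psi>)) \<and>
         (\<forall>B. baire_realiser B \<longrightarrow>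
            (\<exists>\<Psi>. strong_cantor_realiser \<Psi> \<and> computes_given_E2 B \<Psi>))"
  using structure_functional_computes nonmonotone_induction_functional_computes
    baire_realiser_computes by blast

end
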